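(* Let $(S,\lhd,f)$ be a virtual rack. Let $\sigma_{S,\lhd}:S\times S\to S\times S$, $(a,b)\mapsto(b,a\lhd b)$, let $\tau:S\times S\to S\times S$, $(a,b)\mapsto(b,a)$, and let $\tau^f:=(f^{-1}\times f)\circ\tau$. Then the action of $VB_n$ on $S^{\times n}$ associated to the braided object $(S,\sigma_{S,\lhd})$ of the category $\mathbf{Set}_{S,f}$ with symmetric braiding $\tau^f$ is precisely the action $$\zeta_i(a_1,\ldots,a_n)=(a_1,\ldots,a_{i-1},f^{-1}(a_{i+1}),f(a_i),a_{i+2},\ldots,a_n),$$ $$\sigma_i(a_1,\ldots,a_n)=(a_1,\ldots,a_{i-1},a_{i+1},a_i\lhd a_{i+1},a_{i+2},\ldots,a_n).$$
   Context: A shelf is a set $S$ with a binary operation $\lhd$ such that $(a\lhd b)\lhd c=(a\lhd c)\lhd(b\lhd c)$ for all $a,b,c$; it is a rack if moreover $a\mapsto a\lhd b$ is a bijection of $S$ for every $b\in S$. A virtual rack $(S,\lhd,f)$ is a rack with a bijection $f:S\to S$ such that $f(a\lhd b)=f(a)\lhd f(b)$. $\mathbf{Set}_{S,f}$ is the monoidal subcategory of $(\mathbf{Set},\times)$ with objects $S^{\times n}$, $n\ge0$, and with morphisms $S^{\times n}\to S^{\times m}$ the maps $\varphi$ such that $f^{\times m}\circ\varphi=\varphi\circ f^{\times n}$. The braiding $\tau^f$ is given on $S\times S$ by $(f^{-1}\times f)\circ\tau$. The virtual braid group $VB_n$ is the group with generators $\sigma_i,\zeta_i$ $(1\le i\le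 n-1)$ and relations: $\sigma_i\sigma_j=\sigma_j\sigma_i$, $\zeta_i\zeta_j=\zeta_j\zeta_i$, $\sigma_i\zeta_j=\zeta_j\sigma_i$ for $|i-j|>1$; $\zeta_i^2=1$; $\sigma_i\sigma_{i+1}\sigma_i=\sigma_{i+1}\sigma_i\sigma_{i+1}$, $\zeta_i\zeta_{i+1}\zeta_i=\zeta_{i+1}\zeta_i\zeta_{i+1}$, $\zeta_i\zeta_{i+1}\sigma_i=\sigma_{i+1}\zeta_i\zeta_{i+1}$ for $1\le i\le n-2$. The action associated to a braided object $(V,\sigma_V)$ (an object with an invertible solution $\sigma_V:V\otimes V\to V\otimes V$ of the Yang-Baxter equation) and a symmetric braiding $c$ is the group homomorphism $VB_n\to\operatorname{Aut}(V^{\otimes n})$ with $\zeta_i\mapsto\operatorname{Id}_V^{\otimes(i-1)}\otimes c_{V,V}\otimes\operatorname{Id}_V^{\otimes(n-i-1)}$ and $\sigma_i\mapsto\operatorname{Id}_V^{\otimes(i-1)}\otimes\sigma_V\otimes\operatorname{Id}_V^{\otimes(n-i-1)}$.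
   Formalization: For f not the identity, τ^f is not natural for equivariant maps S^m→S^n with m≠n (e.g. S→S^0), so it is not a symmetric braiding on all of Set_{S,f}; it is proved to be one for the maps S^n→S^n only, while the action is taken in Set_{S,f} as stated. *)

theory Defs
  imports "HOL-Algebra.Group_Action"
begin

text \<open>Racks on a carrier set \<open>S\<close>, which may be empty\<close>

locale shelf =
  fixes S :: "'a set" and rop :: "'a \<Rightarrow> 'a \<Rightarrow> 'a"  (infixl "\<triangleleft>" 70)
  assumes closed: "\<lbrakk>a \<in> S; b \<in> S\<rbrakk> \<Longrightarrow> a \<triangleleft> b \<in> S"
    and self_distributive:
      "\<lbrakk>a \<in> S; b \<in> S; c \<in> S\<rbrakk> \<Longrightarrow> (a \<triangleleft> b) \<triangleleft> c = (a \<triangleleft> c) \<triangleleft> (b \<triangleleft> c)"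

locale rack = shelf +
  assumes right_bij: "b \<in> S \<Longrightarrow> bij_betw (\<lambda>a. a \<triangleleft> b) S S"

locale virtual_rack = rack +
  fixes f :: "'a \<Rightarrow> 'a"
  assumes f_bij: "bij_betw f S S"
    and f_hom: "\<lbrakk>a \<in> S; b \<in> S\<rbrakk> \<Longrightarrow> f (a \<triangleleft> b) = f a \<triangleleft> f b"


text \<open>Strict monoidal categories, given by a set of objects and hom-sets.
  Composition \<open>g \<odot> h\<close> is in applicative order (first \<open>h\<close>, then \<open>g\<close>).\<close>

record ('o, 'm) moncat =
  Ob :: "'o set"
  Hom :: "'o \<Rightarrow> 'o \<Rightarrow> 'm set"
  Idt :: "'o \<Rightarrow> 'm"
  Cmp :: "'m \<Rightarrow> 'm \<Rightarrow> 'm"  (infixl "\<odot>\<index>" 65)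
  Unit :: "'o"
  TensO :: "'o \<Rightarrow> 'o \<Rightarrow> 'o"  (infixr "\<boxdot>\<index>" 75)
  TensM :: "'m \<Rightarrow> 'm \<Rightarrow> 'm"  (infixr "\<boxtimes>\<index>" 75)

locale strict_monoidal_category =
  fixes C (structure)
  assumes id_hom: "X \<in> Ob C \<Longrightarrow> Idt C X \<in> Hom C X X"
    and comp_hom: "\<lbrakk>X \<in> Ob C; Y \<in> Ob C; Z \<in> Ob C; g \<in> Hom C Y Z; h \<in> Hom C X Y\<rbrakk>
          \<Longrightarrow> g \<odot> h \<in> Hom C X Z"
    and id_left: "\<lbrakk>X \<in> Ob C; Y \<in> Ob C; g \<in> Hom C X Y\<rbrakk> \<Longrightarrow> Idt C Y \<odot> g = g"
    and id_right: "\<lbrakk>X \<in> Ob C; Y \<in> Ob C; g \<in> Hom C X Y\<rbrakk> \<Longrightarrow> g \<odot> Idt C X = g"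
    and comp_assoc: "\<lbrakk>W \<in> Ob C; X \<in> Ob C; Y \<in> Ob C; Z \<in> Ob C;
          k \<in> Hom C Y Z; g \<in> Hom C X Y; h \<in> Hom C W X\<rbrakk>
          \<Longrightarrow> (k \<odot> g) \<odot> h = k \<odot> (g \<odot> h)"
    and unit_ob: "Unit C \<in> Ob C"
    and tens_ob: "\<lbrakk>X \<in> Ob C; Y \<in> Ob C\<rbrakk> \<Longrightarrow> X \<boxdot> Y \<in> Ob C"
    and tens_hom: "\<lbrakk>X \<in> Ob C; Y \<in> Ob C; X' \<in> Ob C; Y' \<in> Ob C;
          g \<in> Hom C X Y; h \<in> Hom C X' Y'\<rbrakk> \<Longrightarrow> g \<boxtimes> h \<in> Hom C (X \<boxdot> X') (Y \<boxdot> Y')"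
    and tens_id: "\<lbrakk>X \<in> Ob C; Y \<in> Ob C\<rbrakk> \<Longrightarrow> Idt C X \<boxtimes> Idt C Y = Idt C (X \<boxdot> Y)"
    and interchange: "\<lbrakk>X \<in> Ob C; Y \<in> Ob C; Z \<in> Ob C; X' \<in> Ob C; Y' \<in> Ob C; Z' \<in> Ob C;
          g \<in> Hom C Y Z; h \<in> Hom C X Y; g' \<in> Hom C Y' Z'; h' \<in> Hom C X' Y'\<rbrakk>
          \<Longrightarrow> (g \<odot> h) \<boxtimes> (g' \<odot> h') = (g \<boxtimes> g') \<odot> (h \<boxtimes> h')"
    and tens_ob_assoc: "\<lbrakk>X \<in> Ob C; Y \<in> Ob C; Z \<in> Ob C\<rbrakk>
          \<Longrightarrow> (X \<boxdot> Y) \<boxdot> Z = X \<boxdot> (Y \<boxdot> Z)"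
    and tens_ob_unit: "X \<in> Ob C \<Longrightarrow> Unit C \<boxdot> X = X" "X \<in> Ob C \<Longrightarrow> X \<boxdot> Unit C = X"
    and tens_hom_assoc: "\<lbrakk>X \<in> Ob C; Y \<in> Ob C; X' \<in> Ob C; Y' \<in> Ob C; X'' \<in> Ob C; Y'' \<in> Ob C;
          g \<in> Hom C X Y; g' \<in> Hom C X' Y'; g'' \<in> Hom C X'' Y''\<rbrakk>
          \<Longrightarrow> (g \<boxtimes> g') \<boxtimes> g'' = g \<boxtimes> (g' \<boxtimes> g'')"
    and tens_hom_unit:
      "\<lbrakk>X \<in> Ob C; Y \<in> Ob C; g \<in> Hom C X Y\<rbrakk> \<Longrightarrow> Idt C (Unit C) \<boxtimes> g = g"
      "\<lbrakk>X \<in> Ob C; Y \<in> Ob C; g \<in> Hom C X Y\<rbrakk> \<Longrightarrow> g \<boxtimes> Idt C (Unit C) = g"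

locale symmetric_braiding = strict_monoidal_category C for C (structure) +
  fixes c :: "'a \<Rightarrow> 'a \<Rightarrow> 'b"
  assumes braid_hom: "\<lbrakk>X \<in> Ob C; Y \<in> Ob C\<rbrakk> \<Longrightarrow> c X Y \<in> Hom C (X \<boxdot> Y) (Y \<boxdot> X)"
    and symmetric: "\<lbrakk>X \<in> Ob C; Y \<in> Ob C\<rbrakk> \<Longrightarrow> c Y X \<odot> c X Y = Idt C (X \<boxdot> Y)"
    and natural: "\<lbrakk>X \<in> Ob C; Y \<in> Ob C; X' \<in> Ob C; Y' \<in> Ob C;
          g \<in> Hom C X X'; h \<in> Hom C Y Y'\<rbrakk>
          \<Longrightarrow> c X' Y' \<odot> (g \<boxtimes> h) = (h \<boxtimes> g) \<odot> c X Y"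
    and hexagon_right: "\<lbrakk>X \<in> Ob C; Y \<in> Ob C; Z \<in> Ob C\<rbrakk>
          \<Longrightarrow> c X (Y \<boxdot> Z) = (Idt C Y \<boxtimes> c X Z) \<odot> (c X Y \<boxtimes> Idt C Z)"
    and hexagon_left: "\<lbrakk>X \<in> Ob C; Y \<in> Ob C; Z \<in> Ob C\<rbrakk>
          \<Longrightarrow> c (X \<boxdot> Y) Z = (c X Z \<boxtimes> Idt C Y) \<odot> (Idt C X \<boxtimes> c Y Z)"

locale braided_object = strict_monoidal_category C for C (structure) +
  fixes V :: 'a and s :: 'b
  assumes V_ob: "V \<in> Ob C"
    and s_hom: "s \<in> Hom C (V \<boxdot> V) (V \<boxdot> V)"
    and s_invertible: "\<exists>t \<in> Hom C (V \<boxdot> V) (V \<boxdot> V).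
          s \<odot> t = Idt C (V \<boxdot> V) \<and> t \<odot> s = Idt C (V \<boxdot> V)"
    and yang_baxter:
      "(s \<boxtimes> Idt C V) \<odot> (Idt C V \<boxtimes> s) \<odot> (s \<boxtimes> Idt C V)
       = (Idt C V \<boxtimes> s) \<odot> (s \<boxtimes> Idt C V) \<odot> (Idt C V \<boxtimes> s)"

definition aut_group :: "('o, 'm) moncat \<Rightarrow> 'o \<Rightarrow> 'm monoid" where
  "aut_group C X =
    \<lparr> carrier = {g \<in> Hom C X X. \<exists>h \<in> Hom C X X.
         Cmp C g h = Idt C X \<and> Cmp C h g = Idt C X},
      mult = Cmp C,
      one = Idt C X \<rparr>"

primrec obj_pow :: "('o, 'm) moncat \<Rightarrow> 'o \<Rightarrow> nat \<Rightarrow> 'o" where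
  "obj_pow C X 0 = Unit C"
| "obj_pow C X (Suc k) = TensO C X (obj_pow C X k)"

primrec mor_pow :: "('o, 'm) moncat \<Rightarrow> 'm \<Rightarrow> nat \<Rightarrow> 'm" where
  "mor_pow C g 0 = Idt C (Unit C)"
| "mor_pow C g (Suc k) = TensM C g (mor_pow C g k)"

text \<open>\<open>Id\<^sub>V\<^sup>\<otimes>\<^sup>(\<^sup>i\<^sup>-\<^sup>1\<^sup>) \<otimes> g \<otimes> Id\<^sub>V\<^sup>\<otimes>\<^sup>(\<^sup>n\<^sup>-\<^sup>i\<^sup>-\<^sup>1\<^sup>)\<close>, for \<open>1 \<le> i \<le> n - 1\<close>\<close>

definition on_strands :: "('o, 'm) moncat \<Rightarrow> 'o \<Rightarrow> nat \<Rightarrow> nat \<Rightarrow> 'm \<Rightarrow> 'm" where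
  "on_strands C V n i g =
     TensM C (mor_pow C (Idt C V) (i - 1)) (TensM C g (mor_pow C (Idt C V) (n - i - 1)))"


text \<open>Groups given by generators and relations. A letter \<open>(x, True)\<close> stands for the
  generator \<open>x\<close> and \<open>(x, False)\<close> for its formal inverse; the group consists of the words
  modulo the congruence generated by free cancellation and the relations.\<close>

type_synonym 'g word = "('g \<times> bool) list"

inductive pres_eq :: "'g set \<Rightarrow> ('g word \<times> 'g word) set \<Rightarrow> 'g word \<Rightarrow> 'g word \<Rightarrow> bool"
  for X R where
  refl: "u \<in> lists (X \<times> UNIV) \<Longrightarrow> pres_eq X R u u"
| sym: "pres_eq X R u v \<Longrightarrow> pres_eq X R v u"
| trans: "pres_eq X R u v \<Longrightarrow> pres_eq X R v w \<Longrightarrow> pres_eq X R u w"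
| append: "pres_eq X R u u' \<Longrightarrow> pres_eq X R v v' \<Longrightarrow> pres_eq X R (u @ v) (u' @ v')"
| cancel: "x \<in> X \<Longrightarrow> pres_eq X R [(x, e), (x, \<not> e)] []"
| relation: "(u, v) \<in> R \<Longrightarrow> u \<in> lists (X \<times> UNIV) \<Longrightarrow> v \<in> lists (X \<times> UNIV) \<Longrightarrow> pres_eq X R u v"

definition pres_class :: "'g set \<Rightarrow> ('g word \<times> 'g word) set \<Rightarrow> 'g word \<Rightarrow> 'g word set" where
  "pres_class X R u = {v. pres_eq X R u v}"

definition presented_group :: "'g set \<Rightarrow> ('g word \<times> 'g word) set \<Rightarrow> 'g word set monoid" where
  "presented_group X R =
    \<lparr> carrier = pres_class X R ` lists (X \<times> UNIV),
      mult = (\<lambda>A B. \<Union>u\<in>A. \<Union>v\<in>B. pres_class X R (u @ v)),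
      one = pres_class X R [] \<rparr>"



datatype vbgen = Sig nat | Zet nat

definition vb_gens :: "nat \<Rightarrow> vbgen set" where
  "vb_gens n = Sig ` {1..<n} \<union> Zet ` {1..<n}"

definition pos :: "'g list \<Rightarrow> 'g word" where
  "pos xs = map (\<lambda>x. (x, True)) xs"

definition vb_rels :: "nat \<Rightarrow> (vbgen word \<times> vbgen word) set" where
  "vb_rels n =
     {(pos [x i, y j], pos [y j, x i]) | x y i j.
        (x, y) \<in> {(Sig, Sig), (Zet, Zet), (Sig, Zet)} \<and>
        i \<in> {1..<n} \<and> j \<in> {1..<n} \<and> (i + 1 < j \<or> j + 1 < i)}
   \<union> {(pos [Zet i, Zet i], []) | i. i \<in> {1..<n}}
   \<union> {(pos [Sig i, Sig (i + 1), Sig i], pos [Sig (i + 1), Sig i, Sig (i + 1)]) | i.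
        1 \<le> i \<and> i + 1 < n}
   \<union> {(pos [Zet i, Zet (i + 1), Zet i], pos [Zet (i + 1), Zet i, Zet (i + 1)]) | i.
        1 \<le> i \<and> i + 1 < n}
   \<union> {(pos [Zet i, Zet (i + 1), Sig i], pos [Sig (i + 1), Zet i, Zet (i + 1)]) | i.
        1 \<le> i \<and> i + 1 < n}"

definition VB :: "nat \<Rightarrow> vbgen word set monoid" where
  "VB n = presented_group (vb_gens n) (vb_rels n)"

definition vb_sigma :: "nat \<Rightarrow> nat \<Rightarrow> vbgen word set" where
  "vb_sigma n i = pres_class (vb_gens n) (vb_rels n) (pos [Sig i])"

definition vb_zeta :: "nat \<Rightarrow> nat \<Rightarrow> vbgen word set" where
  "vb_zeta n i = pres_class (vb_gens n) (vb_rels n) (pos [Zet i])"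

text \<open>\<open>\<rho>\<close> is the action of \<open>VB n\<close> on the \<open>n\<close>-th tensor power of \<open>V\<close> associated to the braided
  object \<open>(V, s)\<close> and the braiding \<open>c\<close>. Homomorphisms are only determined on the carrier.\<close>

definition associated_action ::
  "('o, 'm) moncat \<Rightarrow> 'o \<Rightarrow> 'm \<Rightarrow> ('o \<Rightarrow> 'o \<Rightarrow> 'm) \<Rightarrow> nat \<Rightarrow> (vbgen word set \<Rightarrow> 'm) \<Rightarrow> bool" where
  "associated_action C V s c n \<rho> \<longleftrightarrow>
     group_hom (VB n) (aut_group C (obj_pow C V n)) \<rho> \<and>
     (\<forall>i \<in> {1..<n}. \<rho> (vb_zeta n i) = on_strands C V n i (c V V) \<and>
                    \<rho> (vb_sigma n i) = on_strands C V n i s)"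


text \<open>The category \<open>Set\<^sub>S\<^sub>,\<^sub>f\<close>. The object \<open>S\<^sup>n\<close> is represented by \<open>n\<close> and its elements by lists of
  length \<open>n\<close>, so that the cartesian product becomes concatenation and is strict. An arrow
  \<open>Arrow m n \<phi>\<close> records source and target, which the tensor product needs.\<close>

definition tuples :: "'a set \<Rightarrow> nat \<Rightarrow> 'a list set" where
  "tuples S n = {xs. set xs \<subseteq> S \<and> length xs = n}"

datatype 'a arrow = Arrow (src: nat) (trg: nat) (fn: "'a list \<Rightarrow> 'a list")

definition Set_Sf :: "'a set \<Rightarrow> ('a \<Rightarrow> 'a) \<Rightarrow> (nat, 'a arrow) moncat" where
  "Set_Sf S f =
    \<lparr> Ob = UNIV,
      Hom = (\<lambda>m n. {Arrow m n \<phi> | \<phi>. \<phi> \<in> tuples S m \<rightarrow>\<^sub>E tuples S n \<and>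
                      (\<forall>xs \<in> tuples S m. map f (\<phi> xs) = \<phi> (map f xs))}),
      Idt = (\<lambda>n. Arrow n n (\<lambda>xs \<in> tuples S n. xs)),
      Cmp = (\<lambda>g h. Arrow (src h) (trg g) (compose (tuples S (src h)) (fn g) (fn h))),
      Unit = 0,
      TensO = (+),
      TensM = (\<lambda>g h. Arrow (src g + src h) (trg g + trg h)
                (\<lambda>xs \<in> tuples S (src g + src h).
                   fn g (take (src g) xs) @ fn h (drop (src g) xs))) \<rparr>"

definition flip :: "'a set \<Rightarrow> 'a arrow" where
  "flip S = Arrow 2 2 (\<lambda>xs \<in> tuples S 2. [xs ! 1, xs ! 0])"

definition arrow1 :: "'a set \<Rightarrow> ('a \<Rightarrow> 'a) \<Rightarrow> 'a arrow" where
  "arrow1 S h = Arrow 1 1 (\<lambda>xs \<in> tuples S 1. map h xs)"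

definition tau_f :: "'a set \<Rightarrow> ('a \<Rightarrow> 'a) \<Rightarrow> 'a arrow" where
  "tau_f S f = Cmp (Set_Sf S f)
     (TensM (Set_Sf S f) (arrow1 S (inv_into S f)) (arrow1 S f)) (flip S)"

definition sigma_rack :: "'a set \<Rightarrow> ('a \<Rightarrow> 'a \<Rightarrow> 'a) \<Rightarrow> 'a arrow" where
  "sigma_rack S rop = Arrow 2 2 (\<lambda>xs \<in> tuples S 2. [xs ! 1, rop (xs ! 0) (xs ! 1)])"

text \<open>The extension of \<open>tau_f\<close> to all objects that the hexagon identities prescribe: every entry
  of the first block picks up one \<open>f\<close> for each entry of the second block it crosses, and every
  entry of the second block one inverse of \<open>f\<close> for each entry of the first block.\<close>

definition braid_f :: "'a set \<Rightarrow> ('a \<Rightarrow> 'a) \<Rightarrow> nat \<Rightarrow> nat \<Rightarrow> 'a arrow" where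
  "braid_f S f m n = Arrow (m + n) (n + m)
     (\<lambda>xs \<in> tuples S (m + n).
        map (inv_into S f ^^ m) (drop m xs) @ map (f ^^ n) (take m xs))"

text \<open>Since \<open>braid_f m n\<close> depends on \<open>m\<close> and \<open>n\<close> through powers of \<open>f\<close>, it is natural only with
  respect to arrows preserving the number of factors. For instance, naturality for the (equivariant)
  map from \<open>S\<close> to the one-point set \<open>S\<^sup>0\<close> would force \<open>f\<close> to be the identity on \<open>S\<close>. Hence
  \<open>braid_f\<close> is a symmetric braiding not for all of \<open>Set\<^sub>S\<^sub>,\<^sub>f\<close> but for the following wide monoidal
  subcategory, which has the same objects and the same automorphism groups.\<close>

definition endo_subcategory :: "('o, 'm) moncat \<Rightarrow> ('o, 'm) moncat" where
  "endo_subcategory C = C\<lparr> Hom := (\<lambda>X Y. if X = Y then Hom C X Y else {}) \<rparr>"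


text \<open>\<open>\<psi>\<close> is the action of \<open>VB n\<close> on the set \<open>S\<^sup>n\<close> given by the explicit formulas. The entry
  \<open>a\<^sub>i\<close> is \<open>a ! (i - 1)\<close>.\<close>

definition explicit_action ::
  "'a set \<Rightarrow> ('a \<Rightarrow> 'a \<Rightarrow> 'a) \<Rightarrow> ('a \<Rightarrow> 'a) \<Rightarrow> nat \<Rightarrow> (vbgen word set \<Rightarrow> 'a list \<Rightarrow> 'a list) \<Rightarrow> bool"
  where
  "explicit_action S rop f n \<psi> \<longleftrightarrow>
     group_action (VB n) (tuples S n) \<psi> \<and>
     (\<forall>i \<in> {1..<n}. \<forall>a \<in> tuples S n.
        \<psi> (vb_zeta n i) a =
          take (i - 1) a @ [inv_into S f (a ! i), f (a ! (i - 1))] @ drop (i + 1) a \<and>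
        \<psi> (vb_sigma n i) a =
          take (i - 1) a @ [a ! i, rop (a ! (i - 1)) (a ! i)] @ drop (i + 1) a)"

end

theory Submission
  imports Defs
begin

text \<open>On lists, \<open>Id \<otimes> g \<otimes> Id\<close> changes at most two adjacent entries. Hence generators acting on disjoint
  pairs of entries commute, and the other defining relations of \<open>VB\<^sub>n\<close> only have to be checked on two
  or three consecutive entries, where they reduce to self-distributivity, to \<open>f\<close> and \<open>f\<^sup>-\<^sup>1\<close> being
  mutually inverse, and to \<open>f\<close> being a rack morphism. The universal property of the presentation then
  yields the associated action. Passing from an automorphism to its underlying map is a homomorphism
  to the group of permutations of \<open>S\<^sup>n\<close>, and two permutation actions with the same values on the
  generators coincide.\<close>


section \<open>Groups given by generators and relations\<close>

lemma pres_eq_lists: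
  assumes "pres_eq X R u v"
  shows "u \<in> lists (X \<times> UNIV) \<and> v \<in> lists (X \<times> UNIV)"
  using assms by induction auto

lemma pres_class_eq:
  assumes "pres_eq X R u v"
  shows "pres_class X R u = pres_class X R v"
  using assms unfolding pres_class_def by (blast intro: pres_eq.sym pres_eq.trans)

lemma pres_class_self: "u \<in> lists (X \<times> UNIV) \<Longrightarrow> u \<in> pres_class X R u"
  by (simp add: pres_class_def pres_eq.refl)

text \<open>The product is a union over all pairs of representatives. Since \<open>pres_eq\<close>
  is a congruence, all classes in this union coincide, and the union is nonempty because a word lies
  in its own class.\<close>

lemma presented_group_mult:
  assumes u: "u \<in> lists (X \<times> UNIV)" and v: "v \<in> lists (X \<times> UNIV)"
  shows "pres_class X R u \<otimes>\<^bsub>presented_group X R\<^esub> pres_class X R v = pres_class X R (u @ v)"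
proof -
  have "pres_class X R (u' @ v') = pres_class X R (u @ v)"
    if "u' \<in> pres_class X R u" "v' \<in> pres_class X R v" for u' v'
    using that by (intro pres_class_eq pres_eq.append) (auto simp: pres_class_def intro: pres_eq.sym)
  moreover have "u \<in> pres_class X R u" "v \<in> pres_class X R v"
    using u v by (auto intro: pres_class_self)
  ultimately have "(\<Union>u'\<in>pres_class X R u. \<Union>v'\<in>pres_class X R v. pres_class X R (u' @ v')) =
      pres_class X R (u @ v)"
    by (intro SUP_eq_const) blast+
  then show ?thesis
    by (simp add: presented_group_def)
qed

lemma presented_group_carrier:
  "carrier (presented_group X R) = pres_class X R ` lists (X \<times> UNIV)"
  by (simp add: presented_group_def)

lemma presented_group_one: "\<one>\<^bsub>presented_group X R\<^esub> = pres_class X R []"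
  by (simp add: presented_group_def)

section \<open>Formal inverses of words and the group axioms\<close>

definition inv_word :: "'g word \<Rightarrow> 'g word" where
  "inv_word w = rev (map (\<lambda>(x, e). (x, \<not> e)) w)"

lemma inv_word_lists: "w \<in> lists (X \<times> UNIV) \<Longrightarrow> inv_word w \<in> lists (X \<times> UNIV)"
  by (auto simp: inv_word_def)

lemma inv_word_cancel:
  assumes "w \<in> lists (X \<times> UNIV)"
  shows "pres_eq X R (inv_word w @ w) []"
  using assms
proof (induction w)
  case Nil
  show ?case by (simp add: inv_word_def pres_eq.refl)
next
  case (Cons l w)
  obtain x e where l: "l = (x, e)" by force
  have x: "x \<in> X" and w: "w \<in> lists (X \<times> UNIV)" using Cons l by auto
  \<comment> \<open>The innermost pair of \<open>inv_word (l # w) @ (l # w)\<close> is removed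
    first; the double negation makes it an instance of \<open>cancel\<close>. What remains is the
    word of the induction hypothesis.\<close>
  have "pres_eq X R ([(x, \<not> e), (x, \<not> \<not> e)] @ w) ([] @ w)"
    by (rule pres_eq.append[OF pres_eq.cancel[OF x] pres_eq.refl[OF w]])
  then have "pres_eq X R (inv_word w @ [(x, \<not> e), (x, e)] @ w) (inv_word w @ w)"
    using pres_eq.append[OF pres_eq.refl[OF inv_word_lists[OF w]]] by simp
  then have "pres_eq X R (inv_word w @ [(x, \<not> e), (x, e)] @ w) []"
    using Cons.IH by (rule pres_eq.trans)
  then show ?case
    by (simp add: inv_word_def l)
qed

lemma presented_group_group: "group (presented_group X R)"
proof (rule groupI)
  let ?G = "presented_group X R"
  fix A B assume "A \<in> carrier ?G" "B \<in> carrier ?G"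
  then show "A \<otimes>\<^bsub>?G\<^esub> B \<in> carrier ?G"
    by (auto simp: presented_group_carrier presented_group_mult del: in_listsD)
next
  let ?G = "presented_group X R"
  fix A B C assume "A \<in> carrier ?G" "B \<in> carrier ?G" "C \<in> carrier ?G"
  then show "A \<otimes>\<^bsub>?G\<^esub> B \<otimes>\<^bsub>?G\<^esub> C = A \<otimes>\<^bsub>?G\<^esub> (B \<otimes>\<^bsub>?G\<^esub> C)"
    by (auto simp: presented_group_carrier presented_group_mult del: in_listsD)
next
  let ?G = "presented_group X R"
  fix A assume "A \<in> carrier ?G"
  then obtain u where u: "u \<in> lists (X \<times> UNIV)" "A = pres_class X R u"
    by (auto simp: presented_group_carrier)
  show "\<one>\<^bsub>?G\<^esub> \<otimes>\<^bsub>?G\<^esub> A = A"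
    using u by (simp add: presented_group_one presented_group_mult)
  have "pres_class X R (inv_word u) \<otimes>\<^bsub>?G\<^esub> A = \<one>\<^bsub>?G\<^esub>"
    using u inv_word_lists[OF u(1)] pres_class_eq[OF inv_word_cancel[OF u(1)]]
    by (simp add: presented_group_one presented_group_mult)
  then show "\<exists>B\<in>carrier ?G. B \<otimes>\<^bsub>?G\<^esub> A = \<one>\<^bsub>?G\<^esub>"
    using inv_word_lists[OF u(1)] by (auto simp: presented_group_carrier)
qed (auto simp: presented_group_carrier presented_group_one)

section \<open>Evaluation of words in a group and the universal property\<close>

definition letter_val :: "('b, 'c) monoid_scheme \<Rightarrow> ('g \<Rightarrow> 'b) \<Rightarrow> 'g \<times> bool \<Rightarrow> 'b" where
  "letter_val G \<phi> l = (if snd l then \<phi> (fst l) else inv\<^bsub>G\<^esub> \<phi> (fst l))"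

definition word_val :: "('b, 'c) monoid_scheme \<Rightarrow> ('g \<Rightarrow> 'b) \<Rightarrow> 'g word \<Rightarrow> 'b" where
  "word_val G \<phi> w = foldr (\<lambda>l y. letter_val G \<phi> l \<otimes>\<^bsub>G\<^esub> y) w \<one>\<^bsub>G\<^esub>"

lemma word_val_simps [simp]:
  "word_val G \<phi> [] = \<one>\<^bsub>G\<^esub>"
  "word_val G \<phi> (l # w) = letter_val G \<phi> l \<otimes>\<^bsub>G\<^esub> word_val G \<phi> w"
  by (simp_all add: word_val_def)

context group
begin

lemma letter_val_closed:
  assumes "\<phi> \<in> X \<rightarrow> carrier G" and "l \<in> X \<times> UNIV"
  shows "letter_val G \<phi> l \<in> carrier G"
  using assms by (auto simp: letter_val_def)

lemma word_val_closed:
  assumes "\<phi> \<in> X \<rightarrow> carrier G" and "w \<in> lists (X \<times> UNIV)"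
  shows "word_val G \<phi> w \<in> carrier G"
  using assms(2) by induction (auto intro: letter_val_closed[OF assms(1)])

lemma word_val_append:
  assumes "\<phi> \<in> X \<rightarrow> carrier G" and "u \<in> lists (X \<times> UNIV)" and "v \<in> lists (X \<times> UNIV)"
  shows "word_val G \<phi> (u @ v) = word_val G \<phi> u \<otimes> word_val G \<phi> v"
  using assms(2)
  by induction (auto simp: m_assoc letter_val_closed[OF assms(1)] word_val_closed[OF assms(1)] assms(3))

text \<open>Having equal values is itself a congruence that contains the free cancellations and the
  relations, so it contains \<open>pres_eq\<close>, which those generate.\<close>

lemma word_val_respects:
  assumes \<phi>: "\<phi> \<in> X \<rightarrow> carrier G"
    and R: "\<And>u v. (u, v) \<in> R \<Longrightarrow> word_val G \<phi> u = word_val G \<phi> v"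
    and uv: "pres_eq X R u v"
  shows "word_val G \<phi> u = word_val G \<phi> v"
  using uv
proof induction
  case (append u u' v v')
  then show ?case
    using pres_eq_lists[OF append.hyps(1)] pres_eq_lists[OF append.hyps(2)]
    by (simp add: word_val_append[OF \<phi>])
next
  case (cancel x e)
  then have "\<phi> x \<in> carrier G" using \<phi> by auto
  then show ?case by (cases e) (auto simp: letter_val_def)
qed (auto simp: R)

text \<open>This is von Dyck's theorem: values for the generators that satisfy the relations extend
  to a homomorphism, namely evaluation of words.\<close>

lemma presented_group_universal:
  assumes \<phi>: "\<phi> \<in> X \<rightarrow> carrier G"
    and R: "\<And>u v. (u, v) \<in> R \<Longrightarrow> word_val G \<phi> u = word_val G \<phi> v"
  shows "\<exists>\<rho>. group_hom (presented_group X R) G \<rho> \<and>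
           (\<forall>x\<in>X. \<rho> (pres_class X R (pos [x])) = \<phi> x)"
proof -
  \<comment> \<open>A class is evaluated on an arbitrarily chosen representative; the choice is
    immaterial by \<open>word_val_respects\<close>.\<close>
  define \<rho> where "\<rho> A = word_val G \<phi> (SOME u. u \<in> A)" for A
  have \<rho>: "\<rho> (pres_class X R u) = word_val G \<phi> u" if "u \<in> lists (X \<times> UNIV)" for u
  proof -
    have "(SOME v. v \<in> pres_class X R u) \<in> pres_class X R u"
      using pres_class_self[OF that] by (rule someI)
    then have "pres_eq X R u (SOME v. v \<in> pres_class X R u)"
      by (simp add: pres_class_def)
    then show ?thesis
      unfolding \<rho>_def using word_val_respects[OF \<phi> R] by metis
  qed
  have "\<rho> \<in> hom (presented_group X R) G"
    by (rule homI)
      (auto simp: presented_group_carrier presented_group_mult \<rho> word_val_append[OF \<phi>]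
        word_val_closed[OF \<phi>] del: in_listsD)
  then have "group_hom (presented_group X R) G \<rho>"
    by (simp add: group_hom_def group_hom_axioms_def presented_group_group is_group)
  moreover have "\<rho> (pres_class X R (pos [x])) = \<phi> x" if "x \<in> X" for x
    using that \<phi> funcset_mem[OF \<phi>] by (subst \<rho>) (auto simp: pos_def letter_val_def)
  ultimately show ?thesis by blast
qed

end

text \<open>Every class is a product of classes of single letters, and a negative letter is the
  inverse of the positive one, so the values on generators determine a homomorphism on the
  carrier.\<close>

lemma presented_group_hom_unique:
  assumes \<rho>: "group_hom (presented_group X R) G \<rho>" and \<psi>: "group_hom (presented_group X R) G \<psi>"
    and gens: "\<And>x. x \<in> X \<Longrightarrow> \<rho> (pres_class X R (pos [x])) = \<psi> (pres_class X R (pos [x]))"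
    and A: "A \<in> carrier (presented_group X R)"
  shows "\<rho> A = \<psi> A"
proof -
  let ?G = "presented_group X R"
  interpret r: group_hom ?G G \<rho> by (rule \<rho>)
  interpret p: group_hom ?G G \<psi> by (rule \<psi>)
  have letter: "\<rho> (pres_class X R [(x, e)]) = \<psi> (pres_class X R [(x, e)])" if x: "x \<in> X" for x e
  proof (cases e)
    case True
    then show ?thesis using gens[OF x] by (simp add: pos_def)
  next
    case False
    have car: "pres_class X R [(x, b)] \<in> carrier ?G" for b
      using x by (auto simp: presented_group_carrier)
    have "pres_class X R [(x, False)] \<otimes>\<^bsub>?G\<^esub> pres_class X R [(x, True)] = \<one>\<^bsub>?G\<^esub>"
      using x pres_class_eq[OF pres_eq.cancel[of x X R False]]
      by (simp add: presented_group_mult presented_group_one)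
    then have "pres_class X R [(x, False)] = inv\<^bsub>?G\<^esub> pres_class X R [(x, True)]"
      by (rule group.inv_equality[OF presented_group_group, symmetric]) (rule car)+
    moreover have "\<rho> (pres_class X R [(x, True)]) = \<psi> (pres_class X R [(x, True)])"
      using gens[OF x] by (simp add: pos_def)
    ultimately show ?thesis
      using False r.hom_inv[OF car] p.hom_inv[OF car] by metis
  qed
  have "\<rho> (pres_class X R u) = \<psi> (pres_class X R u)" if "u \<in> lists (X \<times> UNIV)" for u
    using that
  proof induction
    case Nil
    show ?case
      using r.hom_one p.hom_one by (simp add: presented_group_one)
  next
    case (Cons l u)
    obtain x e where l: "l = (x, e)" "x \<in> X" using Cons by auto
    have "pres_class X R (l # u) = pres_class X R [l] \<otimes>\<^bsub>?G\<^esub> pres_class X R u"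
      using Cons by (subst presented_group_mult) auto
    moreover have "pres_class X R [l] \<in> carrier ?G" "pres_class X R u \<in> carrier ?G"
      using Cons by (auto simp: presented_group_carrier)
    ultimately show ?case
      using letter[OF l(2)] l(1) Cons.IH r.hom_mult p.hom_mult by metis
  qed
  then show ?thesis using A by (auto simp: presented_group_carrier)
qed


section \<open>Automorphisms in a strict monoidal category\<close>

text \<open>Identities, composites and tensor products of endomorphisms are endomorphisms, and all
  equations are inherited from \<open>C\<close>.\<close>

lemma strict_monoidal_endo_subcategory:
  fixes C :: "('o, 'm) moncat"
  assumes "strict_monoidal_category C"
  shows "strict_monoidal_category (endo_subcategory C)"
proof -
  interpret strict_monoidal_category C by fact
  have endo: "Hom (endo_subcategory C) X Y = {g \<in> Hom C X Y. X = Y}"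
    "Ob (endo_subcategory C) = Ob C" "Unit (endo_subcategory C) = Unit C"
    "Cmp (endo_subcategory C) = Cmp C" "TensM (endo_subcategory C) = TensM C"
    "TensO (endo_subcategory C) = TensO C" "Idt (endo_subcategory C) = Idt C" for X Y
    by (auto simp: endo_subcategory_def)
  show ?thesis
    by unfold_locales
      (clarsimp simp: endo, (rule id_hom comp_hom id_left id_right comp_assoc unit_ob tens_ob tens_hom
        tens_id interchange tens_ob_assoc tens_ob_unit tens_hom_assoc tens_hom_unit; assumption))+
qed

lemma aut_group_group:
  fixes C :: "('o, 'm) moncat"
  assumes "strict_monoidal_category C" and X: "X \<in> Ob C"
  shows "group (aut_group C X)"
proof -
  interpret strict_monoidal_category C by fact
  show ?thesis
  proof (rule groupI)
    fix g h assume "g \<in> carrier (aut_group C X)" "h \<in> carrier (aut_group C X)"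
    then obtain g' h' where gh: "g \<in> Hom C X X" "h \<in> Hom C X X" "g' \<in> Hom C X X" "h' \<in> Hom C X X"
      "Cmp C g g' = Idt C X" "Cmp C g' g = Idt C X" "Cmp C h h' = Idt C X" "Cmp C h' h = Idt C X"
      by (auto simp: aut_group_def)
    \<comment> \<open>The inverse of the composite is \<open>Cmp C h' g'\<close>. The inner
      cancellations come first, so that reassociating the two composites finishes the check.\<close>
    have "Cmp C h (Cmp C h' g') = g'" "Cmp C g' (Cmp C g h) = h"
      using gh X comp_assoc[of X X X X h h' g'] comp_assoc[of X X X X g' g h] id_left[of X X]
      by simp_all
    then have "Cmp C (Cmp C g h) (Cmp C h' g') = Idt C X" "Cmp C (Cmp C h' g') (Cmp C g h) = Idt C X"
      using gh X by (simp_all add: comp_assoc[of X X X X] comp_hom[of X X X])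
    then show "g \<otimes>\<^bsub>aut_group C X\<^esub> h \<in> carrier (aut_group C X)"
      using gh X comp_hom[of X X X]
      by (auto simp: aut_group_def intro!: bexI[of _ "Cmp C h' g'"])
  qed (use X in \<open>auto simp: aut_group_def id_hom id_left[of X X] comp_assoc[of X X X X]\<close>)
qed

text \<open>By the interchange law, the tensor product of the inverses is inverse to the tensor
  product.\<close>

lemma aut_group_tens:
  fixes C :: "('o, 'm) moncat"
  assumes "strict_monoidal_category C" and XY: "X \<in> Ob C" "Y \<in> Ob C"
    and g: "g \<in> carrier (aut_group C X)" and h: "h \<in> carrier (aut_group C Y)"
  shows "TensM C g h \<in> carrier (aut_group C (TensO C X Y))"
proof -
  interpret strict_monoidal_category C by fact
  obtain g' h' where gh: "g \<in> Hom C X X" "h \<in> Hom C Y Y" "g' \<in> Hom C X X" "h' \<in> Hom C Y Y"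
    "Cmp C g g' = Idt C X" "Cmp C g' g = Idt C X" "Cmp C h h' = Idt C Y" "Cmp C h' h = Idt C Y"
    using g h by (auto simp: aut_group_def)
  have "Cmp C (TensM C g h) (TensM C g' h') = Idt C (TensO C X Y)"
    "Cmp C (TensM C g' h') (TensM C g h) = Idt C (TensO C X Y)"
    using gh XY by (simp_all add: tens_id flip: interchange[of X X X Y Y Y])
  then show ?thesis
    using gh XY tens_hom by (auto simp: aut_group_def intro!: bexI[of _ "TensM C g' h'"])
qed

lemma obj_pow_Ob:
  fixes C :: "('o, 'm) moncat"
  assumes "strict_monoidal_category C" and "V \<in> Ob C"
  shows "obj_pow C V k \<in> Ob C"
proof -
  interpret strict_monoidal_category C by fact
  show ?thesis by (induction k) (auto simp: unit_ob tens_ob assms)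
qed

lemma mor_pow_Idt:
  fixes C :: "('o, 'm) moncat"
  assumes "strict_monoidal_category C" and "V \<in> Ob C"
  shows "mor_pow C (Idt C V) k = Idt C (obj_pow C V k)"
proof -
  interpret strict_monoidal_category C by fact
  show ?thesis by (induction k) (auto simp: tens_id assms obj_pow_Ob)
qed


section \<open>The category of powers of a set with an operator\<close>

lemma in_tuples_iff: "xs \<in> tuples S n \<longleftrightarrow> set xs \<subseteq> S \<and> length xs = n"
  by (simp add: tuples_def)

lemma tuples_append: "xs \<in> tuples S m \<Longrightarrow> ys \<in> tuples S n \<Longrightarrow> xs @ ys \<in> tuples S (m + n)"
  by (auto simp: in_tuples_iff)

lemma tuples_take: "xs \<in> tuples S (m + n) \<Longrightarrow> take m xs \<in> tuples S m"
  by (auto simp: in_tuples_iff dest: in_set_takeD)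

lemma tuples_drop: "xs \<in> tuples S (m + n) \<Longrightarrow> drop m xs \<in> tuples S n"
  by (auto simp: in_tuples_iff dest: in_set_dropD)

lemma tuples_map: "h ` S \<subseteq> S \<Longrightarrow> xs \<in> tuples S n \<Longrightarrow> map h xs \<in> tuples S n"
  by (auto simp: in_tuples_iff)

lemma tuples_add_iff:
  "xs \<in> tuples S (m + n) \<longleftrightarrow> take m xs \<in> tuples S m \<and> drop m xs \<in> tuples S n"
proof -
  have "set xs = set (take m xs) \<union> set (drop m xs)"
    by (metis append_take_drop_id set_append)
  then show ?thesis
    by (auto simp: in_tuples_iff)
qed

lemma tuples_addE:
  assumes "xs \<in> tuples S (m + n)"
  obtains ys zs where "xs = ys @ zs" "ys \<in> tuples S m" "zs \<in> tuples S n"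
  using assms tuples_add_iff by (metis append_take_drop_id)

lemma tuples_nth: "xs \<in> tuples S n \<Longrightarrow> k < n \<Longrightarrow> xs ! k \<in> S"
  by (auto simp: in_tuples_iff)

lemma tuples_2E:
  assumes "xs \<in> tuples S 2"
  obtains a b where "xs = [a, b]" "a \<in> S" "b \<in> S"
  using assms by (auto simp: in_tuples_iff numeral_2_eq_2 length_Suc_conv)

lemma tuples_3E:
  assumes "xs \<in> tuples S 3"
  obtains a b c where "xs = [a, b, c]" "a \<in> S" "b \<in> S" "c \<in> S"
  using assms by (auto simp: in_tuples_iff numeral_3_eq_3 length_Suc_conv)

section \<open>The strict monoidal structure given by concatenation\<close>

lemma Set_Sf_Hom_iff:
  "g \<in> Hom (Set_Sf S f) m n \<longleftrightarrow>
     src g = m \<and> trg g = n \<and> fn g \<in> extensional (tuples S m) \<and>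
     (\<forall>xs \<in> tuples S m. fn g xs \<in> tuples S n \<and> map f (fn g xs) = fn g (map f xs))"
  by (cases g) (auto simp: Set_Sf_def PiE_iff)

lemma Set_Sf_simps:
  "Ob (Set_Sf S f) = UNIV"
  "Unit (Set_Sf S f) = 0"
  "TensO (Set_Sf S f) = (+)"
  "Idt (Set_Sf S f) n = Arrow n n (\<lambda>xs \<in> tuples S n. xs)"
  "Cmp (Set_Sf S f) g h = Arrow (src h) (trg g) (compose (tuples S (src h)) (fn g) (fn h))"
  "TensM (Set_Sf S f) g h = Arrow (src g + src h) (trg g + trg h)
     (\<lambda>xs \<in> tuples S (src g + src h). fn g (take (src g) xs) @ fn h (drop (src g) xs))"
  by (simp_all add: Set_Sf_def)

text \<open>Outside the tuples both maps take the default value, because they are extensional; only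
  the values on tuples have to be compared.\<close>

lemma arrow_eqI:
  assumes "src g = src h" "trg g = trg h" "fn g \<in> extensional (tuples S (src g))"
    "fn h \<in> extensional (tuples S (src g))"
    "\<And>xs. xs \<in> tuples S (src g) \<Longrightarrow> fn g xs = fn h xs"
  shows "g = h"
  using assms by (intro arrow.expand) (auto intro: extensionalityI)

lemma Set_Sf_strict_monoidal:
  assumes f: "f ` S \<subseteq> S"
  shows "strict_monoidal_category (Set_Sf S f)"
proof -
  let ?C = "Set_Sf S f"
  \<comment> \<open>The length is listed separately since it shows where \<open>take\<close> and
    \<open>drop\<close> cut a concatenation of images.\<close>
  have Hom: "src g = m" "trg g = n" "fn g \<in> extensional (tuples S m)"
    "\<And>xs. xs \<in> tuples S m \<Longrightarrow> fn g xs \<in> tuples S n"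
    "\<And>xs. xs \<in> tuples S m \<Longrightarrow> length (fn g xs) = n"
    "\<And>xs. xs \<in> tuples S m \<Longrightarrow> map f (fn g xs) = fn g (map f xs)"
    if "g \<in> Hom ?C m n" for g m n
    using that by (auto simp: Set_Sf_Hom_iff in_tuples_iff)
  show ?thesis
  proof
    fix X
    show "Idt ?C X \<in> Hom ?C X X"
      by (simp add: Set_Sf_Hom_iff Set_Sf_simps tuples_map[OF f])
  next
    fix X Y Z g h assume g: "g \<in> Hom ?C Y Z" and h: "h \<in> Hom ?C X Y"
    show "Cmp ?C g h \<in> Hom ?C X Z"
      by (simp add: Set_Sf_Hom_iff Set_Sf_simps compose_def tuples_map[OF f] Hom[OF g] Hom[OF h])
  next
    fix X Y g assume g: "g \<in> Hom ?C X Y"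
    show "Cmp ?C (Idt ?C Y) g = g" "Cmp ?C g (Idt ?C X) = g"
      by (rule arrow_eqI[where S = S]; simp add: Set_Sf_simps compose_def Hom[OF g])+
    show "TensM ?C (Idt ?C (Unit ?C)) g = g" "TensM ?C g (Idt ?C (Unit ?C)) = g"
      by (rule arrow_eqI[where S = S];
        simp add: Set_Sf_simps Hom[OF g]; simp add: in_tuples_iff)+
  next
    fix W X Y Z k g h assume k: "k \<in> Hom ?C Y Z" and g: "g \<in> Hom ?C X Y" and h: "h \<in> Hom ?C W X"
    show "Cmp ?C (Cmp ?C k g) h = Cmp ?C k (Cmp ?C g h)"
      by (rule arrow_eqI[where S = S])
        (simp_all add: Set_Sf_simps compose_def Hom[OF k] Hom[OF g] Hom[OF h])
  next
    fix X Y X' Y' g h assume g: "g \<in> Hom ?C X Y" and h: "h \<in> Hom ?C X' Y'"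
    show "TensM ?C g h \<in> Hom ?C (TensO ?C X X') (TensO ?C Y Y')"
      by (simp add: Set_Sf_Hom_iff Set_Sf_simps tuples_add_iff take_map drop_map tuples_map[OF f]
          Hom[OF g] Hom[OF h])
  next
    fix X Y
    show "TensM ?C (Idt ?C X) (Idt ?C Y) = Idt ?C (TensO ?C X Y)"
      by (rule arrow_eqI[where S = S]) (simp_all add: Set_Sf_simps tuples_add_iff)
  next
    fix X Y Z X' Y' Z' g h g' h'
    assume g: "g \<in> Hom ?C Y Z" and h: "h \<in> Hom ?C X Y"
      and g': "g' \<in> Hom ?C Y' Z'" and h': "h' \<in> Hom ?C X' Y'"
    note H = Hom[OF g] Hom[OF h] Hom[OF g'] Hom[OF h']
    show "TensM ?C (Cmp ?C g h) (Cmp ?C g' h') = Cmp ?C (TensM ?C g g') (TensM ?C h h')"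
      by (rule arrow_eqI[where S = S]) (simp_all add: Set_Sf_simps compose_def H tuples_add_iff)
  next
    fix X Y X' Y' X'' Y'' g g' g''
    assume g: "g \<in> Hom ?C X Y" and g': "g' \<in> Hom ?C X' Y'" and g'': "g'' \<in> Hom ?C X'' Y''"
    note H = Hom[OF g] Hom[OF g'] Hom[OF g'']
    \<comment> \<open>The two bracketings cut a list at \<open>X + X'\<close> first or at
      \<open>X\<close> first. Both lead to the same three blocks, which these facts place in the
      right powers of \<open>S\<close>.\<close>
    have tup: "take X xs \<in> tuples S X" "take X' (drop X xs) \<in> tuples S X'"
      "take (X + X') xs \<in> tuples S (X + X')"
      "drop X xs \<in> tuples S (X' + X'')"
      if "xs \<in> tuples S (X + (X' + X''))" for xs
      using that tuples_add_iff[of xs S "X + X'" X''] tuples_add_iff[of xs S X "X' + X''"]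
        tuples_add_iff[of "drop X xs" S X' X'']
      by (simp_all add: add.assoc)
    have drop_add: "drop (X + X') xs = drop X' (drop X xs)" for xs :: "'a list"
      by (simp add: add.commute)
    show "TensM ?C (TensM ?C g g') g'' = TensM ?C g (TensM ?C g' g'')"
      by (intro arrow_eqI[where S = S])
        (simp_all add: Set_Sf_simps H tup add.assoc drop_take drop_add del: drop_drop)
  qed (simp_all add: Set_Sf_simps)
qed

lemma Set_Sf_sides:
  "src (TensM (Set_Sf S f) g h) = src g + src h" "trg (TensM (Set_Sf S f) g h) = trg g + trg h"
  "src (Cmp (Set_Sf S f) g h) = src h" "trg (Cmp (Set_Sf S f) g h) = trg g"
  "src (Idt (Set_Sf S f) n) = n" "trg (Idt (Set_Sf S f) n) = n"
  "src h = n \<Longrightarrow> fn (Cmp (Set_Sf S f) g h) \<in> extensional (tuples S n)"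
  "fn (Idt (Set_Sf S f) n) \<in> extensional (tuples S n)"
  by (simp_all add: Set_Sf_simps)

lemma fn_Idt: "xs \<in> tuples S n \<Longrightarrow> fn (Idt (Set_Sf S f) n) xs = xs"
  by (simp add: Set_Sf_simps)

lemma fn_Cmp: "xs \<in> tuples S (src h) \<Longrightarrow> fn (Cmp (Set_Sf S f) g h) xs = fn g (fn h xs)"
  by (simp add: Set_Sf_simps compose_def)

lemma fn_TensM:
  assumes "xs \<in> tuples S (src g)" "ys \<in> tuples S (src h)"
  shows "fn (TensM (Set_Sf S f) g h) (xs @ ys) = fn g xs @ fn h ys"
proof -
  have "length xs = src g" using assms by (simp add: in_tuples_iff)
  then show ?thesis using tuples_append[OF assms] by (simp add: Set_Sf_simps)
qed

section \<open>Maps that change two adjacent entries\<close>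

definition pair_update :: "('a \<Rightarrow> 'a \<Rightarrow> 'a) \<Rightarrow> ('a \<Rightarrow> 'a \<Rightarrow> 'a) \<Rightarrow> nat \<Rightarrow> 'a list \<Rightarrow> 'a list" where
  "pair_update p q k xs =
     xs[k := p (xs ! k) (xs ! Suc k), Suc k := q (xs ! k) (xs ! Suc k)]"

text \<open>The two pairs of positions are disjoint, so neither map reads or writes an entry that
  the other one changes.\<close>

lemma pair_update_far:
  assumes "Suc k < l \<or> Suc l < k"
  shows "pair_update p q k (pair_update p' q' l xs) = pair_update p' q' l (pair_update p q k xs)"
  using assms
  by (auto simp: pair_update_def list_update_swap)

text \<open>This is the shape of the explicit formulas. Strands are numbered from 1 and list
  positions from 0, so the pair of strands \<open>i\<close>, \<open>i + 1\<close> sits at positions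
  \<open>i - 1\<close>, \<open>i\<close>.\<close>

lemma pair_update_conv:
  assumes "1 \<le> i" "i < length xs"
  shows "pair_update p q (i - 1) xs =
    take (i - 1) xs @ [p (xs ! (i - 1)) (xs ! i), q (xs ! (i - 1)) (xs ! i)] @ drop (i + 1) xs"
  using assms
  by (cases i) (auto simp: pair_update_def upd_conv_take_nth_drop nth_append take_Suc_conv_app_nth)

lemma pair_update_append:
  "pair_update p q (length us) (us @ a # b # vs) = us @ p a b # q a b # vs"
  by (simp add: pair_update_def nth_append list_update_append)

lemma pair_update_append_Suc:
  "pair_update p q (Suc (length us)) (us @ c # a # b # vs) = us @ c # p a b # q a b # vs"
  using pair_update_append[of p q "us @ [c]" a b vs] by simp

lemma obj_pow_Set_Sf: "obj_pow (Set_Sf S f) 1 k = k"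
  by (induction k) (auto simp: Set_Sf_simps)

lemma on_strands_Set_Sf:
  assumes f: "f ` S \<subseteq> S" and i: "i \<in> {1..<n}"
  shows "on_strands (Set_Sf S f) 1 n i g =
    TensM (Set_Sf S f) (Idt (Set_Sf S f) (i - 1))
      (TensM (Set_Sf S f) g (Idt (Set_Sf S f) (n - i - 1)))"
  by (simp add: on_strands_def mor_pow_Idt[OF Set_Sf_strict_monoidal[OF f]] obj_pow_Set_Sf
      Set_Sf_simps(1) del: One_nat_def)

text \<open>A tensor product of automorphisms is an automorphism, and identities are
  automorphisms.\<close>

lemma on_strands_Aut:
  assumes f: "f ` S \<subseteq> S" and i: "i \<in> {1..<n}"
    and g: "g \<in> carrier (aut_group (Set_Sf S f) 2)"
  shows "on_strands (Set_Sf S f) 1 n i g \<in> carrier (aut_group (Set_Sf S f) n)"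
proof -
  let ?C = "Set_Sf S f"
  note C = Set_Sf_strict_monoidal[OF f]
  interpret strict_monoidal_category ?C by (rule C)
  have Id: "Idt ?C k \<in> carrier (aut_group ?C k)" for k
    using group.is_monoid[OF aut_group_group[OF C, of k], THEN monoid.one_closed]
    by (simp add: aut_group_def Set_Sf_simps(1))
  have "TensM ?C (Idt ?C (i - 1)) (TensM ?C g (Idt ?C (n - i - 1)))
      \<in> carrier (aut_group ?C (TensO ?C (i - 1) (TensO ?C 2 (n - i - 1))))"
    by (intro aut_group_tens[OF C] Id g) (auto simp: Set_Sf_simps(1))
  moreover have "TensO ?C (i - 1) (TensO ?C 2 (n - i - 1)) = n"
    using i by (auto simp: Set_Sf_simps)
  ultimately show ?thesis
    using on_strands_Set_Sf[OF f i] by simp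
qed

text \<open>Here the categorical description becomes an explicit one: the tensor product cuts the
  tuple into the first \<open>i - 1\<close> entries, the pair on which \<open>g\<close> acts, and
  the rest, and the identities leave the outer blocks alone.\<close>

lemma fn_on_strands:
  assumes f: "f ` S \<subseteq> S" and i: "i \<in> {1..<n}" and g: "src g = 2"
    and pq: "\<And>a b. a \<in> S \<Longrightarrow> b \<in> S \<Longrightarrow> fn g [a, b] = [p a b, q a b]"
    and xs: "xs \<in> tuples S n"
  shows "fn (on_strands (Set_Sf S f) 1 n i g) xs = pair_update p q (i - 1) xs"
proof -
  define m where "m = n - i - 1"
  have n: "n = i - 1 + (2 + m)" using i by (auto simp: m_def)
  have len: "length xs = n" using xs by (simp add: in_tuples_iff)
  have d: "drop (i - 1) xs = xs ! (i - 1) # xs ! i # drop (i + 1) xs"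
    using i len by (cases i) (simp_all add: Cons_nth_drop_Suc)
  have t: "take (i - 1) xs \<in> tuples S (i - 1)" "drop (i - 1) xs \<in> tuples S (2 + m)"
    using xs n tuples_take tuples_drop by metis+
  have "drop (i + 1) xs \<in> tuples S m"
    using tuples_drop[OF t(2)] i by (cases i) (auto simp: numeral_2_eq_2)
  then have *: "fn (on_strands (Set_Sf S f) 1 n i g) xs =
      take (i - 1) xs @ fn g [xs ! (i - 1), xs ! i] @ drop (i + 1) xs"
    using xs t d n on_strands_Set_Sf[OF f i, of g] g unfolding m_def[symmetric]
    by (simp add: Set_Sf_simps numeral_2_eq_2)
  have i': "i - 1 < n" using i by auto
  have "take (i - 1) xs @ fn g [xs ! (i - 1), xs ! i] @ drop (i + 1) xs = pair_update p q (i - 1) xs"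
    using i i' len pair_update_conv[of i xs p q]
      pq[OF tuples_nth[OF xs, of "i - 1"] tuples_nth[OF xs, of i]] by simp
  with * show ?thesis by simp
qed

text \<open>The inverse arrow supplies the inverse map. Arrows are extensional and compose by
  \<open>compose\<close> on tuples, exactly as the elements of \<open>BijGroup\<close> do, so no
  further identification is required.\<close>

lemma fn_aut_group_BijGroup:
  "fn \<in> hom (aut_group (Set_Sf S f) n) (BijGroup (tuples S n))"
proof (rule homI)
  let ?A = "aut_group (Set_Sf S f) n"
  have Bij: "fn g \<in> Bij (tuples S n)" if "g \<in> carrier ?A" for g
  proof -
    from that obtain h where gh: "g \<in> Hom (Set_Sf S f) n n" "h \<in> Hom (Set_Sf S f) n n"
      "Cmp (Set_Sf S f) g h = Idt (Set_Sf S f) n" "Cmp (Set_Sf S f) h g = Idt (Set_Sf S f) n"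
      by (auto simp: aut_group_def)
    have "fn g (fn h xs) = xs" "fn h (fn g xs) = xs" if "xs \<in> tuples S n" for xs
      using gh that by (auto simp: Set_Sf_simps Set_Sf_Hom_iff compose_def restrict_def fun_eq_iff) metis+
    then have "bij_betw (fn g) (tuples S n) (tuples S n)"
      using gh by (intro bij_betw_byWitness[where f' = "fn h"]) (auto simp: Set_Sf_Hom_iff)
    then show ?thesis using gh by (auto simp: Bij_def Set_Sf_Hom_iff PiE_iff)
  qed
  fix g h assume gh: "g \<in> carrier ?A" "h \<in> carrier ?A"
  show "fn g \<in> carrier (BijGroup (tuples S n))" using Bij gh by (simp add: BijGroup_def)
  show "fn (g \<otimes>\<^bsub>?A\<^esub> h) = fn g \<otimes>\<^bsub>BijGroup (tuples S n)\<^esub> fn h"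
    using Bij[OF gh(1)] Bij[OF gh(2)] gh(2)
    by (auto simp: BijGroup_def aut_group_def Set_Sf_simps Set_Sf_Hom_iff)
qed


section \<open>Virtual racks\<close>

context virtual_rack
begin

abbreviation "fi \<equiv> inv_into S f"

section \<open>Powers of \<open>f\<close> and of its inverse\<close>

lemma f_image: "f ` S \<subseteq> S"
  using f_bij by (auto simp: bij_betw_def)

lemma f_closed: "a \<in> S \<Longrightarrow> f a \<in> S"
  using f_image by auto

lemma fi_closed: "a \<in> S \<Longrightarrow> fi a \<in> S"
  using f_bij by (metis bij_betw_def inv_into_into)

lemma f_fi: "a \<in> S \<Longrightarrow> f (fi a) = a"
  using f_bij by (metis bij_betw_inv_into_right)

lemma fi_f: "a \<in> S \<Longrightarrow> fi (f a) = a"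
  using f_bij by (metis bij_betw_inv_into_left)

lemma f_pow_closed: "a \<in> S \<Longrightarrow> (f ^^ k) a \<in> S"
  by (induction k) (auto simp: f_closed)

lemma fi_pow_closed: "a \<in> S \<Longrightarrow> (fi ^^ k) a \<in> S"
  by (induction k) (auto simp: fi_closed)

lemma f_pow_fi_pow: "a \<in> S \<Longrightarrow> (f ^^ k) ((fi ^^ k) a) = a"
  by (induction k) (simp_all add: funpow_swap1[of f] f_fi fi_pow_closed)

lemma fi_pow_f_pow: "a \<in> S \<Longrightarrow> (fi ^^ k) ((f ^^ k) a) = a"
  by (induction k) (simp_all add: funpow_swap1[of fi] fi_f f_pow_closed)

lemma f_fi_pow: "a \<in> S \<Longrightarrow> f ((fi ^^ k) a) = (fi ^^ k) (f a)"
proof (induction k)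
  case (Suc k)
  \<comment> \<open>Moving \<open>f\<close> outwards by the induction hypothesis lets it cancel
    against one \<open>fi\<close> on either side, leaving \<open>(fi ^^ k) a\<close> twice.\<close>
  then show ?case by (simp add: f_fi fi_f fi_pow_closed flip: Suc.IH)
qed simp

lemma tuples_map_pow:
  assumes "xs \<in> tuples S n"
  shows "map (f ^^ k) xs \<in> tuples S n" and "map (fi ^^ k) xs \<in> tuples S n"
  using assms by (auto intro!: tuples_map f_pow_closed fi_pow_closed)

lemma map_pow_inverse:
  assumes "xs \<in> tuples S n"
  shows "map (f ^^ k) (map (fi ^^ k) xs) = xs" and "map (fi ^^ k) (map (f ^^ k) xs) = xs"
  using assms by (auto simp: in_tuples_iff f_pow_fi_pow fi_pow_f_pow intro!: map_idI)

lemma strict_monoidal: "strict_monoidal_category (Set_Sf S f)"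
  by (rule Set_Sf_strict_monoidal[OF f_image])

text \<open>Equivariance under \<open>f\<close> iterates to its powers and then passes to the
  inverse powers. This is what naturality of \<open>braid_f\<close> rests on.\<close>

lemma Hom_pow_commute:
  assumes g: "g \<in> Hom (Set_Sf S f) m n" and xs: "xs \<in> tuples S m"
  shows "map (f ^^ k) (fn g xs) = fn g (map (f ^^ k) xs)"
    and "map (fi ^^ k) (fn g xs) = fn g (map (fi ^^ k) xs)"
proof -
  have f_pow: "map (f ^^ k) (fn g ys) = fn g (map (f ^^ k) ys)" if ys: "ys \<in> tuples S m" for ys k
  proof (induction k)
    case (Suc k)
    have "map (f ^^ Suc k) (fn g ys) = map f (fn g (map (f ^^ k) ys))"
      by (simp flip: Suc.IH)
    also have "\<dots> = fn g (map f (map (f ^^ k) ys))"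
      using g tuples_map_pow(1)[OF ys] by (auto simp: Set_Sf_Hom_iff simp del: map_map)
    finally show ?case by (simp add: comp_def)
  qed simp
  show "map (f ^^ k) (fn g xs) = fn g (map (f ^^ k) xs)" by (rule f_pow[OF xs])
  have "fn g (map (fi ^^ k) xs) \<in> tuples S n"
    using g tuples_map_pow(2)[OF xs] by (auto simp: Set_Sf_Hom_iff)
  \<comment> \<open>The inverse powers are reached by inserting \<open>fi ^^ k\<close> after
    \<open>f ^^ k\<close> and pulling \<open>f ^^ k\<close> through \<open>g\<close>, where it
    cancels.\<close>
  then have "fn g (map (fi ^^ k) xs) = map (fi ^^ k) (map (f ^^ k) (fn g (map (fi ^^ k) xs)))"
    using map_pow_inverse(2) by metis
  also have "\<dots> = map (fi ^^ k) (fn g xs)"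
    using f_pow[OF tuples_map_pow(2)[OF xs]] map_pow_inverse(1)[OF xs] by simp
  finally show "map (fi ^^ k) (fn g xs) = fn g (map (fi ^^ k) xs)" by simp
qed

section \<open>The symmetric braiding on all powers of \<open>S\<close>\<close>

lemma braid_f_simps:
  "src (braid_f S f m n) = m + n" "trg (braid_f S f m n) = n + m"
  "l = m + n \<Longrightarrow> fn (braid_f S f m n) \<in> extensional (tuples S l)"
  by (simp_all add: braid_f_def)

lemma fn_braid_f:
  assumes "xs \<in> tuples S m" "ys \<in> tuples S n"
  shows "fn (braid_f S f m n) (xs @ ys) = map (fi ^^ m) ys @ map (f ^^ n) xs"
proof -
  have "length xs = m" using assms by (simp add: in_tuples_iff)
  then show ?thesis using tuples_append[OF assms] by (simp add: braid_f_def)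
qed

lemma braid_f_Hom: "braid_f S f m n \<in> Hom (Set_Sf S f) (m + n) (n + m)"
proof -
  have "fn (braid_f S f m n) xs \<in> tuples S (n + m) \<and>
      map f (fn (braid_f S f m n) xs) = fn (braid_f S f m n) (map f xs)"
    if xs: "xs \<in> tuples S (m + n)" for xs
  proof -
    from xs obtain us vs where uv: "xs = us @ vs" "us \<in> tuples S m" "vs \<in> tuples S n"
      by (rule tuples_addE)
    \<comment> \<open>Equivariance of the braiding reduces to \<open>f\<close> commuting with its
      own powers and with those of its inverse.\<close>
    have "f ((f ^^ k) a) = (f ^^ k) (f a)" "f ((fi ^^ k) a) = (fi ^^ k) (f a)" if "a \<in> S" for a k
      using that by (simp_all add: funpow_swap1 f_fi_pow)
    then have "map f (map (f ^^ n) us) = map (f ^^ n) (map f us)"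
      "map f (map (fi ^^ m) vs) = map (fi ^^ m) (map f vs)"
      using uv by (auto simp: in_tuples_iff)
    then show ?thesis
      using uv tuples_map[OF f_image uv(2)] tuples_map[OF f_image uv(3)]
      by (simp add: fn_braid_f tuples_append tuples_map_pow del: map_map)
  qed
  then show ?thesis by (simp add: Set_Sf_Hom_iff braid_f_simps)
qed

lemma braid_f_1_1: "braid_f S f 1 1 = tau_f S f"
proof (rule arrow_eqI[where S = S])
  fix xs assume "xs \<in> tuples S (src (braid_f S f 1 1))"
  then have "xs \<in> tuples S 2" by (simp add: braid_f_simps numeral_2_eq_2)
  then obtain a b where "xs = [a, b]" "a \<in> S" "b \<in> S" by (rule tuples_2E)
  then show "fn (braid_f S f 1 1) xs = fn (tau_f S f) xs"
    by (simp add: braid_f_def tau_f_def Set_Sf_simps flip_def arrow1_def compose_def in_tuples_iff)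
qed (simp_all add: braid_f_simps tau_f_def Set_Sf_simps flip_def arrow1_def numeral_2_eq_2)

text \<open>Crossing back undoes the powers picked up on the way, which gives symmetry. Naturality
  is equivariance under powers of \<open>f\<close> and \<open>fi\<close>, and the hexagons express
  that exponents add when blocks are crossed in succession.\<close>

lemma symmetric_braiding_braid_f:
  "symmetric_braiding (endo_subcategory (Set_Sf S f)) (braid_f S f)"
proof -
  let ?C = "Set_Sf S f"
  let ?b = "braid_f S f"
  have endo: "Hom (endo_subcategory ?C) X Y = {g \<in> Hom ?C X Y. X = Y}"
    "Cmp (endo_subcategory ?C) = Cmp ?C" "TensM (endo_subcategory ?C) = TensM ?C"
    "TensO (endo_subcategory ?C) = (+)" "Idt (endo_subcategory ?C) = Idt ?C" for X Y
    by (auto simp: endo_subcategory_def Set_Sf_simps)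
  interpret strict_monoidal_category "endo_subcategory ?C"
    by (rule strict_monoidal_endo_subcategory[OF strict_monoidal])
  show ?thesis
  proof
    fix X Y
    show "?b X Y \<in> Hom (endo_subcategory ?C) (TensO (endo_subcategory ?C) X Y)
        (TensO (endo_subcategory ?C) Y X)"
      using braid_f_Hom by (simp add: endo add.commute)
  next
    fix X Y
    have "fn (Cmp ?C (?b Y X) (?b X Y)) xs = xs" if xs: "xs \<in> tuples S (X + Y)" for xs
    proof -
      from xs obtain us vs where uv: "xs = us @ vs" "us \<in> tuples S X" "vs \<in> tuples S Y"
        by (rule tuples_addE)
      then show ?thesis
        using xs by (simp add: fn_Cmp braid_f_simps fn_braid_f tuples_map_pow map_pow_inverse del: map_map)
    qed
    then show "Cmp (endo_subcategory ?C) (?b Y X) (?b X Y) =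
        Idt (endo_subcategory ?C) (TensO (endo_subcategory ?C) X Y)"
      by (intro arrow_eqI[where S = S]) (simp_all add: endo Set_Sf_sides braid_f_simps fn_Idt)
  next
    fix X Y X' Y' g h
    assume "g \<in> Hom (endo_subcategory ?C) X X'" "h \<in> Hom (endo_subcategory ?C) Y Y'"
    \<comment> \<open>Arrows of the subcategory preserve the number of factors, so both sides of the
      naturality square carry the same exponents.\<close>
    then have X': "X' = X" "Y' = Y" and g: "g \<in> Hom ?C X X" and h: "h \<in> Hom ?C Y Y"
      by (auto simp: endo)
    have st: "src g = X" "trg g = X" "src h = Y" "trg h = Y"
      using g h by (auto simp: Set_Sf_Hom_iff)
    have "fn (Cmp ?C (?b X Y) (TensM ?C g h)) xs = fn (Cmp ?C (TensM ?C h g) (?b X Y)) xs"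
      if xs: "xs \<in> tuples S (X + Y)" for xs
    proof -
      from xs obtain us vs where uv: "xs = us @ vs" "us \<in> tuples S X" "vs \<in> tuples S Y"
        by (rule tuples_addE)
      then have "fn g us \<in> tuples S X" "fn h vs \<in> tuples S Y"
        using g h by (auto simp: Set_Sf_Hom_iff)
      then show ?thesis
        using xs uv
        by (simp add: fn_Cmp fn_TensM Set_Sf_sides st braid_f_simps fn_braid_f tuples_map_pow
            Hom_pow_commute[OF g] Hom_pow_commute[OF h] del: map_map)
    qed
    then show "Cmp (endo_subcategory ?C) (?b X' Y') (TensM (endo_subcategory ?C) g h) =
        Cmp (endo_subcategory ?C) (TensM (endo_subcategory ?C) h g) (?b X Y)"
      unfolding X'
      by (intro arrow_eqI[where S = S]) (simp_all add: endo Set_Sf_sides st braid_f_simps)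
  next
    fix X Y Z
    let ?P = "TensM ?C (Idt ?C Y) (?b X Z)" and ?Q = "TensM ?C (?b X Y) (Idt ?C Z)"
    have "fn (?b X (Y + Z)) xs = fn (Cmp ?C ?P ?Q) xs" if xs: "xs \<in> tuples S (X + (Y + Z))" for xs
    proof -
      from xs obtain us ws where "xs = us @ ws" and us: "us \<in> tuples S X" and "ws \<in> tuples S (Y + Z)"
        by (rule tuples_addE)
      moreover from \<open>ws \<in> tuples S (Y + Z)\<close> obtain vs ws' where "ws = vs @ ws'"
        and vs: "vs \<in> tuples S Y" and ws: "ws' \<in> tuples S Z"
        by (rule tuples_addE)
      ultimately have xs_eq: "xs = us @ vs @ ws'" by simp
      have Q: "fn ?Q ((us @ vs) @ ws') = (map (fi ^^ X) vs @ map (f ^^ Y) us) @ ws'"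
        using us vs ws by (subst fn_TensM) (simp_all add: Set_Sf_sides braid_f_simps tuples_append fn_braid_f fn_Idt)
      have P: "fn ?P (map (fi ^^ X) vs @ (map (f ^^ Y) us @ ws')) =
          map (fi ^^ X) vs @ map (fi ^^ X) ws' @ map (f ^^ Z) (map (f ^^ Y) us)"
        using us vs ws
        by (subst fn_TensM)
          (simp_all add: Set_Sf_sides braid_f_simps tuples_append tuples_map_pow fn_braid_f fn_Idt del: map_map)
      \<comment> \<open>An entry of the first block crosses first \<open>Y\<close> and then
        \<open>Z\<close> entries.\<close>
      have "(f ^^ Z) \<circ> (f ^^ Y) = f ^^ (Y + Z)"
        by (simp add: add.commute flip: funpow_add)
      then show ?thesis
        using xs us vs ws P Q unfolding xs_eq
        by (simp add: fn_Cmp Set_Sf_sides braid_f_simps fn_braid_f tuples_append add.assoc)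
    qed
    then show "?b X (TensO (endo_subcategory ?C) Y Z) =
        Cmp (endo_subcategory ?C)
         (TensM (endo_subcategory ?C) (Idt (endo_subcategory ?C) Y) (?b X Z))
         (TensM (endo_subcategory ?C) (?b X Y) (Idt (endo_subcategory ?C) Z))"
      by (intro arrow_eqI[where S = S]) (simp_all add: endo Set_Sf_sides braid_f_simps add.assoc)
  next
    fix X Y Z
    let ?P = "TensM ?C (?b X Z) (Idt ?C Y)" and ?Q = "TensM ?C (Idt ?C X) (?b Y Z)"
    \<comment> \<open>Now the last block moves: its entries cross \<open>Y\<close> and then
      \<open>X\<close> entries, and the inverse powers compose to
      \<open>fi ^^ (X + Y)\<close>.\<close>
    have "fn (?b (X + Y) Z) xs = fn (Cmp ?C ?P ?Q) xs" if xs: "xs \<in> tuples S (X + (Y + Z))" for xs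
    proof -
      from xs obtain us ws where "xs = us @ ws" and us: "us \<in> tuples S X" and "ws \<in> tuples S (Y + Z)"
        by (rule tuples_addE)
      moreover from \<open>ws \<in> tuples S (Y + Z)\<close> obtain vs ws' where "ws = vs @ ws'"
        and vs: "vs \<in> tuples S Y" and ws: "ws' \<in> tuples S Z"
        by (rule tuples_addE)
      ultimately have xs_eq: "xs = us @ vs @ ws'" by simp
      have Q: "fn ?Q (us @ (vs @ ws')) = us @ map (fi ^^ Y) ws' @ map (f ^^ Z) vs"
        using us vs ws by (subst fn_TensM) (simp_all add: Set_Sf_sides braid_f_simps tuples_append fn_braid_f fn_Idt)
      have P: "fn ?P ((us @ map (fi ^^ Y) ws') @ map (f ^^ Z) vs) =
          (map (fi ^^ X) (map (fi ^^ Y) ws') @ map (f ^^ Z) us) @ map (f ^^ Z) vs"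
        using us vs ws
        by (subst fn_TensM)
          (simp_all add: Set_Sf_sides braid_f_simps tuples_append tuples_map_pow fn_braid_f fn_Idt del: map_map)
      have b: "fn (?b (X + Y) Z) ((us @ vs) @ ws') = map (fi ^^ (X + Y)) ws' @ map (f ^^ Z) (us @ vs)"
        using us vs ws by (intro fn_braid_f tuples_append)
      show ?thesis
        using xs us vs ws P Q b unfolding xs_eq
        by (simp add: fn_Cmp Set_Sf_sides braid_f_simps tuples_append funpow_add)
    qed
    then show "?b (TensO (endo_subcategory ?C) X Y) Z =
        Cmp (endo_subcategory ?C)
         (TensM (endo_subcategory ?C) (?b X Z) (Idt (endo_subcategory ?C) Y))
         (TensM (endo_subcategory ?C) (Idt (endo_subcategory ?C) X) (?b Y Z))"
      by (intro arrow_eqI[where S = S]) (simp_all add: endo Set_Sf_sides braid_f_simps add.assoc)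
  qed
qed

section \<open>The rack as a braided object\<close>

lemma rdiv:
  assumes "y \<in> S" "x \<in> S"
  shows "inv_into S (\<lambda>a. a \<triangleleft> x) y \<in> S" and "inv_into S (\<lambda>a. a \<triangleleft> x) y \<triangleleft> x = y"
    and "inv_into S (\<lambda>a. a \<triangleleft> x) (y \<triangleleft> x) = y"
proof -
  note bij = right_bij[OF assms(2)]
  show "inv_into S (\<lambda>a. a \<triangleleft> x) y \<in> S"
    using bij assms(1) by (auto simp: bij_betw_def intro: inv_into_into)
  show "inv_into S (\<lambda>a. a \<triangleleft> x) y \<triangleleft> x = y"
    using bij_betw_inv_into_right[OF bij assms(1)] .
  show "inv_into S (\<lambda>a. a \<triangleleft> x) (y \<triangleleft> x) = y"
    using bij_betw_inv_into_left[OF bij assms(1)] .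
qed

text \<open>Apply \<open>f\<close> to the equation that defines the quotient, then divide by
  \<open>f x\<close>. This makes the inverse of \<open>sigma_rack\<close> equivariant.\<close>

lemma f_rdiv:
  assumes "y \<in> S" "x \<in> S"
  shows "f (inv_into S (\<lambda>a. a \<triangleleft> x) y) = inv_into S (\<lambda>a. a \<triangleleft> f x) (f y)"
proof -
  let ?d = "inv_into S (\<lambda>a. a \<triangleleft> x) y"
  have "f ?d \<triangleleft> f x = f y"
    using rdiv[OF assms] assms by (simp flip: f_hom)
  then show ?thesis
    using rdiv(3)[of "f ?d" "f x"] rdiv(1)[OF assms] assms by (simp add: f_closed)
qed

lemma fn_sigma_rack: "a \<in> S \<Longrightarrow> b \<in> S \<Longrightarrow> fn (sigma_rack S (\<triangleleft>)) [a, b] = [b, a \<triangleleft> b]"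
  by (simp add: sigma_rack_def in_tuples_iff)

lemma sigma_rack_sides:
  "src (sigma_rack S (\<triangleleft>)) = 2" "trg (sigma_rack S (\<triangleleft>)) = 2"
  "fn (sigma_rack S (\<triangleleft>)) \<in> extensional (tuples S 2)"
  by (simp_all add: sigma_rack_def)

lemma sigma_rack_Hom: "sigma_rack S (\<triangleleft>) \<in> Hom (Set_Sf S f) 2 2"
proof -
  let ?s = "sigma_rack S (\<triangleleft>)"
  have "fn ?s xs \<in> tuples S 2 \<and> map f (fn ?s xs) = fn ?s (map f xs)" if "xs \<in> tuples S 2" for xs
    using that by (rule tuples_2E) (simp add: in_tuples_iff fn_sigma_rack closed f_closed f_hom)
  then show ?thesis by (simp add: Set_Sf_Hom_iff sigma_rack_sides)
qed

lemma sigma_rack_invertible: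
  "\<exists>t \<in> Hom (Set_Sf S f) 2 2. Cmp (Set_Sf S f) (sigma_rack S (\<triangleleft>)) t = Idt (Set_Sf S f) 2 \<and>
     Cmp (Set_Sf S f) t (sigma_rack S (\<triangleleft>)) = Idt (Set_Sf S f) 2"
proof -
  let ?C = "Set_Sf S f" and ?s = "sigma_rack S (\<triangleleft>)"
  \<comment> \<open>Solving \<open>(b, a \<triangleleft> b) = (x, y)\<close> gives
    \<open>b = x\<close>, and \<open>a\<close> is the quotient of \<open>y\<close> by right
    translation with \<open>x\<close>.\<close>
  define t where
    "t = Arrow 2 2 (\<lambda>xs \<in> tuples S 2. [inv_into S (\<lambda>a. a \<triangleleft> xs ! 0) (xs ! 1), xs ! 0])"
  have t_sides: "src t = 2" "trg t = 2" "fn t \<in> extensional (tuples S 2)"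
    by (simp_all add: t_def)
  have fn_t: "fn t [a, b] = [inv_into S (\<lambda>x. x \<triangleleft> a) b, a]" if "a \<in> S" "b \<in> S" for a b
    using that by (simp add: t_def in_tuples_iff)
  have "fn t xs \<in> tuples S 2 \<and> map f (fn t xs) = fn t (map f xs)" if "xs \<in> tuples S 2" for xs
    using that by (rule tuples_2E) (simp add: in_tuples_iff fn_t rdiv f_rdiv f_closed)
  then have "t \<in> Hom ?C 2 2" by (simp add: Set_Sf_Hom_iff t_sides)
  moreover have "fn ?s (fn t xs) = xs" "fn t (fn ?s xs) = xs" if "xs \<in> tuples S 2" for xs
    using that by (auto elim!: tuples_2E simp: fn_sigma_rack fn_t rdiv closed)
  then have "Cmp ?C ?s t = Idt ?C 2" "Cmp ?C t ?s = Idt ?C 2"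
    by (auto intro!: arrow_eqI[where S = S]
        simp: Set_Sf_sides fn_Cmp fn_Idt t_sides sigma_rack_sides)
  ultimately show ?thesis by blast
qed

text \<open>On a triple, both sides have first entries \<open>c\<close> and
  \<open>b \<triangleleft> c\<close>; the third entries are
  \<open>(a \<triangleleft> b) \<triangleleft> c\<close> and
  \<open>(a \<triangleleft> c) \<triangleleft> (b \<triangleleft> c)\<close>, which agree by
  self-distributivity.\<close>

lemma sigma_rack_yang_baxter:
  fixes C s i
  defines "C \<equiv> Set_Sf S f" and "s \<equiv> sigma_rack S (\<triangleleft>)" and "i \<equiv> Idt (Set_Sf S f) 1"
  shows "Cmp C (Cmp C (TensM C s i) (TensM C i s)) (TensM C s i) =
    Cmp C (Cmp C (TensM C i s) (TensM C s i)) (TensM C i s)"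
proof (rule arrow_eqI[where S = S])
  let ?L = "Cmp C (Cmp C (TensM C s i) (TensM C i s)) (TensM C s i)"
  have src: "src s = 2" "trg s = 2" "src i = 1" "trg i = 1"
    by (simp_all add: s_def i_def sigma_rack_def Set_Sf_simps)
  show "src ?L = src (Cmp C (Cmp C (TensM C i s) (TensM C s i)) (TensM C i s))"
    "trg ?L = trg (Cmp C (Cmp C (TensM C i s) (TensM C s i)) (TensM C i s))"
    "fn ?L \<in> extensional (tuples S (src ?L))"
    "fn (Cmp C (Cmp C (TensM C i s) (TensM C s i)) (TensM C i s)) \<in> extensional (tuples S (src ?L))"
    by (simp_all add: C_def Set_Sf_sides src)
  have s12: "fn (TensM C s i) [a, b, c] = [b, a \<triangleleft> b, c]" "fn (TensM C i s) [a, b, c] = [a, c, b \<triangleleft> c]"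
    if "a \<in> S" "b \<in> S" "c \<in> S" for a b c
  proof -
    have s: "fn s [x, y] = [y, x \<triangleleft> y]" if "x \<in> S" "y \<in> S" for x y
      using that by (simp add: s_def fn_sigma_rack)
    have i: "fn i [x] = [x]" if "x \<in> S" for x
      unfolding i_def using that by (intro fn_Idt) (simp add: in_tuples_iff)
    show "fn (TensM C s i) [a, b, c] = [b, a \<triangleleft> b, c]"
      using that fn_TensM[of "[a, b]" S s "[c]" i f] by (simp add: C_def src in_tuples_iff s i)
    show "fn (TensM C i s) [a, b, c] = [a, c, b \<triangleleft> c]"
      using that fn_TensM[of "[a]" S i "[b, c]" s f] by (simp add: C_def src in_tuples_iff s i)
  qed
  fix xs assume "xs \<in> tuples S (src ?L)"
  then have "xs \<in> tuples S 3" by (simp add: C_def Set_Sf_simps src)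
  then obtain a b c where xs: "xs = [a, b, c]" and abc: "a \<in> S" "b \<in> S" "c \<in> S"
    by (rule tuples_3E)
  have Cmp: "fn (Cmp C g h) [x, y, z] = fn g (fn h [x, y, z])"
    if "src h = 3" "x \<in> S" "y \<in> S" "z \<in> S" for g h x y z
    unfolding C_def using that by (intro fn_Cmp) (simp add: in_tuples_iff)
  have src3: "src (TensM C s i) = 3" "src (TensM C i s) = 3" "src (Cmp C g h) = src h" for g h
    using src by (simp_all add: C_def Set_Sf_simps)
  show "fn ?L xs = fn (Cmp C (Cmp C (TensM C i s) (TensM C s i)) (TensM C i s)) xs"
    using abc by (simp add: xs Cmp src3 s12 closed self_distributive[OF abc])
qed

lemma braided_object_sigma_rack: "braided_object (Set_Sf S f) 1 (sigma_rack S (\<triangleleft>))"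
proof -
  have V: "TensO (Set_Sf S f) 1 1 = 2" by (simp add: Set_Sf_simps)
  interpret strict_monoidal_category "Set_Sf S f" by (rule strict_monoidal)
  show ?thesis
    by unfold_locales
      (use sigma_rack_Hom sigma_rack_invertible sigma_rack_yang_baxter in
        \<open>simp_all only: V Set_Sf_simps(1) UNIV_I\<close>)
qed

lemma sigma_rack_Aut: "sigma_rack S (\<triangleleft>) \<in> carrier (aut_group (Set_Sf S f) 2)"
  using sigma_rack_Hom sigma_rack_invertible by (simp add: aut_group_def)

text \<open>By symmetry the braiding of the object \<open>1\<close> with itself is its own
  inverse.\<close>

lemma braid_f_Aut: "braid_f S f 1 1 \<in> carrier (aut_group (Set_Sf S f) 2)"
proof -
  have "Cmp (Set_Sf S f) (braid_f S f 1 1) (braid_f S f 1 1) = Idt (Set_Sf S f) (1 + 1)"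
    using symmetric_braiding.symmetric[OF symmetric_braiding_braid_f, of 1 1]
    by (simp add: endo_subcategory_def Set_Sf_simps(1,3))
  then show ?thesis
    using braid_f_Hom[of 1 1] by (auto simp: aut_group_def numeral_2_eq_2)
qed

section \<open>The generators of \<open>VB n\<close> as maps on tuples and as arrows\<close>

definition gen_act :: "vbgen \<Rightarrow> 'a list \<Rightarrow> 'a list" where
  "gen_act g = (case g of
      Sig i \<Rightarrow> pair_update (\<lambda>a b. b) (\<lambda>a b. a \<triangleleft> b) (i - 1)
    | Zet i \<Rightarrow> pair_update (\<lambda>a b. fi b) (\<lambda>a b. f a) (i - 1))"

definition gen_arrow :: "nat \<Rightarrow> vbgen \<Rightarrow> 'a arrow" where
  "gen_arrow n g = (case g of
      Sig i \<Rightarrow> on_strands (Set_Sf S f) 1 n i (sigma_rack S (\<triangleleft>))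
    | Zet i \<Rightarrow> on_strands (Set_Sf S f) 1 n i (braid_f S f 1 1))"

lemma gen_arrow_Aut:
  assumes "g \<in> vb_gens n"
  shows "gen_arrow n g \<in> carrier (aut_group (Set_Sf S f) n)"
  using assms on_strands_Aut[OF f_image _ sigma_rack_Aut] on_strands_Aut[OF f_image _ braid_f_Aut]
  by (auto simp: gen_arrow_def vb_gens_def)

lemma fn_gen_arrow:
  assumes "g \<in> vb_gens n" "xs \<in> tuples S n"
  shows "fn (gen_arrow n g) xs = gen_act g xs"
proof -
  have "fn (braid_f S f 1 1) [a, b] = [fi b, f a]" if "a \<in> S" "b \<in> S" for a b
    using that fn_braid_f[of "[a]" 1 "[b]" 1] by (simp add: in_tuples_iff)
  then have "fn (on_strands (Set_Sf S f) 1 n i (braid_f S f 1 1)) xs = gen_act (Zet i) xs"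
    if "i \<in> {1..<n}" for i
    unfolding gen_act_def vbgen.case using that assms(2)
    by (intro fn_on_strands[OF f_image]) (simp_all add: braid_f_simps)
  moreover have "fn (on_strands (Set_Sf S f) 1 n i (sigma_rack S (\<triangleleft>))) xs = gen_act (Sig i) xs"
    if "i \<in> {1..<n}" for i
    unfolding gen_act_def vbgen.case using that assms(2) fn_sigma_rack
    by (intro fn_on_strands[OF f_image]) (simp_all add: sigma_rack_def)
  ultimately show ?thesis
    using assms(1) by (auto simp: vb_gens_def gen_arrow_def)
qed

text \<open>All relations are between positive words, so they can be tested by composing maps;
  \<open>foldr\<close> applies the rightmost letter first, in line with applicative composition in
  the category.\<close>

lemma gen_act_rels:
  assumes "(u, v) \<in> vb_rels n"
  obtains gs hs where "u = pos gs" "v = pos hs" "set gs \<subseteq> vb_gens n" "set hs \<subseteq> vb_gens n"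
    "\<And>xs. xs \<in> tuples S n \<Longrightarrow> foldr gen_act gs xs = foldr gen_act hs xs"
proof -
  have far: "gen_act (x i) (gen_act (y j) xs) = gen_act (y j) (gen_act (x i) xs)"
    if "(x, y) \<in> {(Sig, Sig), (Zet, Zet), (Sig, Zet)}" "1 \<le> i" "1 \<le> j" "i + 1 < j \<or> j + 1 < i"
    for x y i j xs
  proof -
    \<comment> \<open>As \<open>i\<close> and \<open>j\<close> are at least 1, truncated subtraction
      keeps the gap between the pairs.\<close>
    have "Suc (i - 1) < j - 1 \<or> Suc (j - 1) < i - 1" using that by linarith
    then show ?thesis
      using that(1) by (auto simp: gen_act_def intro: pair_update_far)
  qed
  have braid: "foldr gen_act [Sig i, Sig (i + 1), Sig i] xs = foldr gen_act [Sig (i + 1), Sig i, Sig (i + 1)] xs"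
    "foldr gen_act [Zet i, Zet (i + 1), Zet i] xs = foldr gen_act [Zet (i + 1), Zet i, Zet (i + 1)] xs"
    "foldr gen_act [Zet i, Zet (i + 1), Sig i] xs = foldr gen_act [Sig (i + 1), Zet i, Zet (i + 1)] xs"
    if i: "1 \<le> i" "i + 1 < n" and xs: "xs \<in> tuples S n" for i xs
  proof -
    \<comment> \<open>The tuple is cut around the three strands \<open>i\<close>,
      \<open>i + 1\<close>, \<open>i + 2\<close>, the only ones that these relations touch.\<close>
    have "xs \<in> tuples S ((i - 1) + (3 + (n - i - 2)))" using xs i by simp
    then obtain us ws where 1: "xs = us @ ws" "us \<in> tuples S (i - 1)" "ws \<in> tuples S (3 + (n - i - 2))"
      by (rule tuples_addE)
    from 1(3) obtain vs ws' where 2: "ws = vs @ ws'" "vs \<in> tuples S 3" by (rule tuples_addE)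
    from 2(2) obtain a b c where 3: "vs = [a, b, c]" "a \<in> S" "b \<in> S" "c \<in> S" by (rule tuples_3E)
    have len: "i - 1 = length us" "i + 1 - 1 = Suc (length us)"
      using 1(2) i by (auto simp: in_tuples_iff)
    have *: "gen_act (Sig i) (us @ x # y # zs) = us @ y # (x \<triangleleft> y) # zs"
      "gen_act (Zet i) (us @ x # y # zs) = us @ fi y # f x # zs"
      "gen_act (Sig (i + 1)) (us @ w # x # y # zs) = us @ w # y # (x \<triangleleft> y) # zs"
      "gen_act (Zet (i + 1)) (us @ w # x # y # zs) = us @ w # fi y # f x # zs" for w x y zs
      unfolding gen_act_def vbgen.case len by (simp_all add: pair_update_append pair_update_append_Suc)
    show "foldr gen_act [Sig i, Sig (i + 1), Sig i] xs = foldr gen_act [Sig (i + 1), Sig i, Sig (i + 1)] xs"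
      "foldr gen_act [Zet i, Zet (i + 1), Zet i] xs = foldr gen_act [Zet (i + 1), Zet i, Zet (i + 1)] xs"
      "foldr gen_act [Zet i, Zet (i + 1), Sig i] xs = foldr gen_act [Sig (i + 1), Zet i, Zet (i + 1)] xs"
      \<comment> \<open>The relation for \<open>Sig\<close> is self-distributivity. The one for
        \<open>Zet\<close> compares \<open>f (fi b)\<close> with \<open>fi (f b)\<close> in the
        middle. The mixed one compares \<open>f (a \<triangleleft> b)\<close> with
        \<open>f a \<triangleleft> f b\<close> at the end.\<close>
      using 3 by (simp_all only: foldr.simps comp_apply id_apply 1(1) 2(1) 3(1) * append_Cons append_Nil
          self_distributive[OF 3(2-4)] f_fi fi_f f_hom)
  qed
  have sq: "gen_act (Zet i) (gen_act (Zet i) xs) = xs"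
    if i: "1 \<le> i" "i < n" and xs: "xs \<in> tuples S n" for i xs
  proof -
    have "(i - 1) + (2 + (n - i - 1)) = n" using i by arith
    then have "xs \<in> tuples S ((i - 1) + (2 + (n - i - 1)))" using xs by (simp only:)
    then obtain us ws where 1: "xs = us @ ws" "us \<in> tuples S (i - 1)" "ws \<in> tuples S (2 + (n - i - 1))"
      by (rule tuples_addE)
    from 1(3) obtain vs ws' where 2: "ws = vs @ ws'" "vs \<in> tuples S 2" by (rule tuples_addE)
    from 2(2) obtain a b where 3: "vs = [a, b]" "a \<in> S" "b \<in> S" by (rule tuples_2E)
    have len: "i - 1 = length us" using 1(2) by (simp add: in_tuples_iff)
    show ?thesis
      using 3 unfolding gen_act_def vbgen.case len 1(1) 2(1) 3(1)
      by (simp add: pair_update_append f_fi fi_f)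
  qed
  \<comment> \<open>The empty word is written as \<open>pos []\<close>, so that every case provides
    a positive word on either side.\<close>
  from assms consider
    x y i j where "u = pos [x i, y j]" "v = pos [y j, x i]" "(x, y) \<in> {(Sig, Sig), (Zet, Zet), (Sig, Zet)}"
      "i \<in> {1..<n}" "j \<in> {1..<n}" "i + 1 < j \<or> j + 1 < i"
  | i where "u = pos [Zet i, Zet i]" "v = pos []" "i \<in> {1..<n}"
  | i where "1 \<le> i" "i + 1 < n" "u = pos [Sig i, Sig (i + 1), Sig i]" "v = pos [Sig (i + 1), Sig i, Sig (i + 1)]"
  | i where "1 \<le> i" "i + 1 < n" "u = pos [Zet i, Zet (i + 1), Zet i]" "v = pos [Zet (i + 1), Zet i, Zet (i + 1)]"
  | i where "1 \<le> i" "i + 1 < n" "u = pos [Zet i, Zet (i + 1), Sig i]" "v = pos [Sig (i + 1), Zet i, Zet (i + 1)]"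
    unfolding vb_rels_def by (elim UnE CollectE exE conjE) (auto simp: pos_def)
  then show thesis
  proof cases
    case 1
    show thesis
      by (rule that[OF 1(1,2)]) (use 1 far[OF 1(3)] in \<open>auto simp: vb_gens_def\<close>)
  next
    case 2
    show thesis
      by (rule that[OF 2(1,2)]) (use 2 sq in \<open>auto simp: vb_gens_def\<close>)
  next
    case 3
    show thesis
      by (rule that[OF 3(3,4)]) (use 3 braid(1) in \<open>auto simp: vb_gens_def\<close>)
  next
    case 4
    show thesis
      by (rule that[OF 4(3,4)]) (use 4 braid(2) in \<open>auto simp: vb_gens_def\<close>)
  next
    case 5
    show thesis
      by (rule that[OF 5(3,4)]) (use 5 braid(3) in \<open>auto simp: vb_gens_def\<close>)
  qed
qed

text \<open>No inverses occur in a positive word, so its value in the automorphism group has the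
  composite of the explicit maps as underlying map. Relations between arrows can then be checked on
  tuples.\<close>

lemma word_val_pos:
  assumes "set gs \<subseteq> vb_gens n"
  defines "A \<equiv> aut_group (Set_Sf S f) n"
  shows "word_val A (gen_arrow n) (pos gs) \<in> carrier A \<and>
    (\<forall>xs \<in> tuples S n. fn (word_val A (gen_arrow n) (pos gs)) xs = foldr gen_act gs xs)"
  using assms(1)
proof (induction gs)
  case Nil
  interpret group A
    unfolding A_def by (rule aut_group_group[OF strict_monoidal]) (simp add: Set_Sf_simps)
  have "\<one>\<^bsub>A\<^esub> = Idt (Set_Sf S f) n" by (simp add: A_def aut_group_def)
  then show ?case using one_closed by (simp add: pos_def fn_Idt)
next
  case (Cons g gs)
  interpret group A
    unfolding A_def by (rule aut_group_group[OF strict_monoidal]) (simp add: Set_Sf_simps)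
  let ?w = "word_val A (gen_arrow n) (pos gs)"
  have g: "g \<in> vb_gens n" and w: "?w \<in> carrier A"
    and IH: "\<And>xs. xs \<in> tuples S n \<Longrightarrow> fn ?w xs = foldr gen_act gs xs"
    using Cons by auto
  have val: "word_val A (gen_arrow n) (pos (g # gs)) = gen_arrow n g \<otimes>\<^bsub>A\<^esub> ?w"
    by (simp add: pos_def letter_val_def)
  have "?w \<in> Hom (Set_Sf S f) n n" using w by (simp add: A_def aut_group_def)
  then have "src ?w = n" "\<And>xs. xs \<in> tuples S n \<Longrightarrow> fn ?w xs \<in> tuples S n"
    by (auto simp: Set_Sf_Hom_iff)
  then have "fn (gen_arrow n g \<otimes>\<^bsub>A\<^esub> ?w) xs = foldr gen_act (g # gs) xs" if "xs \<in> tuples S n" for xs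
    using that IH fn_gen_arrow[OF g] by (simp add: A_def aut_group_def fn_Cmp)
  moreover have "gen_arrow n g \<otimes>\<^bsub>A\<^esub> ?w \<in> carrier A"
    by (rule m_closed[OF _ w]) (simp add: A_def gen_arrow_Aut[OF g])
  ultimately show ?case unfolding val by blast
qed

section \<open>The associated action and its explicit form\<close>

lemma Sig_Zet_in_vb_gens: "i \<in> {1..<n} \<Longrightarrow> Sig i \<in> vb_gens n \<and> Zet i \<in> vb_gens n"
  by (auto simp: vb_gens_def)

text \<open>The universal property applies because the two sides of each relation evaluate to arrows
  with equal underlying maps on tuples, hence to equal arrows.\<close>

lemma associated_action_exists:
  "\<exists>\<rho>. associated_action (Set_Sf S f) 1 (sigma_rack S (\<triangleleft>)) (braid_f S f) n \<rho>"
proof -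
  let ?A = "aut_group (Set_Sf S f) n"
  have A: "group ?A"
    by (rule aut_group_group[OF strict_monoidal]) (simp add: Set_Sf_simps)
  have "word_val ?A (gen_arrow n) u = word_val ?A (gen_arrow n) v" if uv: "(u, v) \<in> vb_rels n" for u v
  proof -
    from uv obtain gs hs where u: "u = pos gs" "set gs \<subseteq> vb_gens n" and v: "v = pos hs" "set hs \<subseteq> vb_gens n"
      and eq: "\<And>xs. xs \<in> tuples S n \<Longrightarrow> foldr gen_act gs xs = foldr gen_act hs xs"
      using gen_act_rels by metis
    have "word_val ?A (gen_arrow n) u \<in> Hom (Set_Sf S f) n n"
      "word_val ?A (gen_arrow n) v \<in> Hom (Set_Sf S f) n n"
      using word_val_pos[OF u(2)] word_val_pos[OF v(2)] unfolding u v by (auto simp: aut_group_def)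
    moreover have "fn (word_val ?A (gen_arrow n) u) xs = fn (word_val ?A (gen_arrow n) v) xs"
      if "xs \<in> tuples S n" for xs
      using word_val_pos[OF u(2)] word_val_pos[OF v(2)] eq[OF that] that unfolding u v by simp
    ultimately show ?thesis
      by (intro arrow_eqI[where S = S]) (simp_all add: Set_Sf_Hom_iff)
  qed
  then obtain \<rho> where "group_hom (VB n) ?A \<rho>"
    and "\<And>x. x \<in> vb_gens n \<Longrightarrow> \<rho> (pres_class (vb_gens n) (vb_rels n) (pos [x])) = gen_arrow n x"
    using group.presented_group_universal[OF A, of "gen_arrow n" "vb_gens n" "vb_rels n"] gen_arrow_Aut
    unfolding VB_def by blast
  then have "associated_action (Set_Sf S f) 1 (sigma_rack S (\<triangleleft>)) (braid_f S f) n \<rho>"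
    unfolding associated_action_def vb_sigma_def vb_zeta_def obj_pow_Set_Sf
    using Sig_Zet_in_vb_gens by (simp add: gen_arrow_def del: One_nat_def)
  then show ?thesis by (rule exI[of _ \<rho>])
qed

text \<open>Composition with \<open>fn\<close> turns the homomorphism into automorphisms into a
  permutation action, and \<open>fn_gen_arrow\<close> reads off its values on the
  generators.\<close>

lemma associated_action_explicit:
  assumes "associated_action (Set_Sf S f) 1 (sigma_rack S (\<triangleleft>)) (braid_f S f) n \<rho>"
  shows "explicit_action S (\<triangleleft>) f n (\<lambda>g. fn (\<rho> g))"
proof -
  have hom: "group_hom (VB n) (aut_group (Set_Sf S f) n) \<rho>"
    and gens: "\<And>i. i \<in> {1..<n} \<Longrightarrow> \<rho> (vb_zeta n i) = gen_arrow n (Zet i)"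
      "\<And>i. i \<in> {1..<n} \<Longrightarrow> \<rho> (vb_sigma n i) = gen_arrow n (Sig i)"
    using assms by (auto simp: associated_action_def obj_pow_Set_Sf gen_arrow_def simp del: One_nat_def)
  interpret group_hom "VB n" "aut_group (Set_Sf S f) n" \<rho> by (rule hom)
  have "fn \<circ> \<rho> \<in> hom (VB n) (BijGroup (tuples S n))"
    by (rule Group.hom_compose[OF homh fn_aut_group_BijGroup])
  then have "group_action (VB n) (tuples S n) (\<lambda>g. fn (\<rho> g))"
    unfolding comp_def
    by (intro group_action.intro group_hom.intro group_hom_axioms.intro G.is_group group_BijGroup)
  moreover have "fn (\<rho> (vb_zeta n i)) a =
        take (i - 1) a @ [fi (a ! i), f (a ! (i - 1))] @ drop (i + 1) a"
      "fn (\<rho> (vb_sigma n i)) a =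
        take (i - 1) a @ [a ! i, a ! (i - 1) \<triangleleft> a ! i] @ drop (i + 1) a"
    if "i \<in> {1..<n}" "a \<in> tuples S n" for i a
  proof -
    have "1 \<le> i" "i < length a" using that by (auto simp: in_tuples_iff)
    note conv = pair_update_conv[OF this]
    show "fn (\<rho> (vb_zeta n i)) a = take (i - 1) a @ [fi (a ! i), f (a ! (i - 1))] @ drop (i + 1) a"
      using Sig_Zet_in_vb_gens[OF that(1)] unfolding gens[OF that(1)]
      by (subst fn_gen_arrow) (auto simp only: that gen_act_def vbgen.case conv)
    show "fn (\<rho> (vb_sigma n i)) a = take (i - 1) a @ [a ! i, a ! (i - 1) \<triangleleft> a ! i] @ drop (i + 1) a"
      using Sig_Zet_in_vb_gens[OF that(1)] unfolding gens[OF that(1)]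
      by (subst fn_gen_arrow) (auto simp only: that gen_act_def vbgen.case conv)
  qed
  ultimately show ?thesis
    unfolding explicit_action_def by blast
qed

text \<open>The formulas fix the values of the generators on tuples, and permutations in
  \<open>BijGroup\<close> are extensional, so two such actions agree on the generators as functions
  and therefore on all of \<open>VB n\<close>.\<close>

lemma explicit_action_unique:
  assumes \<phi>: "explicit_action S (\<triangleleft>) f n \<phi>" and \<psi>: "explicit_action S (\<triangleleft>) f n \<psi>"
    and g: "g \<in> carrier (VB n)"
  shows "\<psi> g = \<phi> g"
proof (rule presented_group_hom_unique[where G = "BijGroup (tuples S n)"])
  show hom: "group_hom (presented_group (vb_gens n) (vb_rels n)) (BijGroup (tuples S n)) \<psi>"
    "group_hom (presented_group (vb_gens n) (vb_rels n)) (BijGroup (tuples S n)) \<phi>"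
    using \<phi> \<psi> by (auto simp: explicit_action_def group_action_def VB_def)
  show "g \<in> carrier (presented_group (vb_gens n) (vb_rels n))"
    using g by (simp add: VB_def)
  fix x assume x: "x \<in> vb_gens n"
  let ?x = "pres_class (vb_gens n) (vb_rels n) (pos [x])"
  have "?x \<in> carrier (presented_group (vb_gens n) (vb_rels n))"
    using x by (auto simp: presented_group_carrier pos_def)
  then have "\<psi> ?x \<in> extensional (tuples S n)" "\<phi> ?x \<in> extensional (tuples S n)"
    using group_hom.hom_closed[OF hom(1)] group_hom.hom_closed[OF hom(2)]
    by (auto simp: BijGroup_def Bij_def)
  moreover have "\<psi> ?x a = \<phi> ?x a" if "a \<in> tuples S n" for a
    using x that \<phi> \<psi> by (auto simp: vb_gens_def explicit_action_def vb_zeta_def vb_sigma_def)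
  ultimately show "\<psi> ?x = \<phi> ?x" by (rule extensionalityI)
qed

end

theorem proposition4p2:
  fixes S :: "'a set" and rop :: "'a \<Rightarrow> 'a \<Rightarrow> 'a" and f :: "'a \<Rightarrow> 'a" and n :: nat
  assumes "virtual_rack S rop f"
  shows "braided_object (Set_Sf S f) 1 (sigma_rack S rop) \<and>
    symmetric_braiding (endo_subcategory (Set_Sf S f)) (braid_f S f) \<and>
    braid_f S f 1 1 = tau_f S f \<and>
    (\<exists>\<rho>. associated_action (Set_Sf S f) 1 (sigma_rack S rop) (braid_f S f) n \<rho>) \<and>
    (\<forall>\<rho>. associated_action (Set_Sf S f) 1 (sigma_rack S rop) (braid_f S f) n \<rho> \<longrightarrow>
       explicit_action S rop f n (\<lambda>g. fn (\<rho> g)) \<and>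
       (\<forall>\<psi>. explicit_action S rop f n \<psi> \<longrightarrow> (\<forall>g \<in> carrier (VB n). \<psi> g = fn (\<rho> g))))"
proof -
  interpret virtual_rack S rop f by (rule assms)
  show ?thesis
    using braided_object_sigma_rack symmetric_braiding_braid_f braid_f_1_1 associated_action_exists
      associated_action_explicit explicit_action_unique by blast
qed

end
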